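(* Let $S$ be a (finite) triangulation of a closed connected surface with Euler characteristic $\chi(S)\ge 0$, regarded as a $2$-dimensional simplicial complex. Then $S$ is balanced.
   Context: A closed surface is a compact connected $2$-manifold without boundary, not assumed orientable. For a nonempty finite simplicial complex $T$ let $f_i(T)$ be the number of $i$-dimensional simplexes of $T$, and $\mu_i(T)=f_0(T)/f_i(T)$ (with $\mu_i(T)=\infty$, $1/\mu_i(T)=0$ if $f_i(T)=0$). For fixed $r$ and $T$ nonempty of dimension $\le r$, let $\mu(T)=\{(\alpha_1,\dots,\alpha_r)\in\mathbf R^r:\ \alpha_i\ge 0,\ \sum_{i=1}^r\alpha_i/\mu_i(T)<1\}$. The reduced density domain of $S$ is $\tilde\mu(S)=\bigcap_{T\subset S}\mu(T)\subset\mathbf R^r$, the intersection over all nonempty subcomplexes $T\subset S$. An $r$-dimensional simplicial complex $S$ is called balanced if $\tilde\mu(S)=\mu(S)$. (Here $r=2$.) *)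

theory Defs
  imports "HOL-Analysis.Analysis"
begin

definition topological_manifold :: "nat \<Rightarrow> 'a topology \<Rightarrow> bool" where
  "topological_manifold n M \<longleftrightarrow>
     Hausdorff_space M \<and> second_countable M \<and>
     (\<forall>x \<in> topspace M. \<exists>U V. openin M U \<and> x \<in> U \<and> openin (Euclidean_space n) V \<and>
        subtopology M U homeomorphic_space subtopology (Euclidean_space n) V)"

text \<open>Charts are onto open subsets of the whole plane, so there is no boundary. Nonemptiness is
  explicit because the empty space satisfies \<^const>\<open>connected_space\<close>.\<close>

definition closed_surface :: "'a topology \<Rightarrow> bool" where
  "closed_surface M \<longleftrightarrow>
     topological_manifold 2 M \<and> compact_space M \<and> connected_space M \<and> topspace M \<noteq> {}"

text \<open>Finite simplicial complexes are the geometric ones of the library. Being closed under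
  faces, they contain the empty simplex (of dimension -1) as soon as they have any member.
  Thus a complex is nonempty in the usual sense iff its underlying space is nonempty.\<close>

definition triangulates :: "'a::euclidean_space set set \<Rightarrow> 'b topology \<Rightarrow> bool" where
  "triangulates S M \<longleftrightarrow> simplicial_complex S \<and> top_of_set (\<Union>S) homeomorphic_space M"

definition subcomplex :: "'a::euclidean_space set set \<Rightarrow> 'a set set \<Rightarrow> bool" where
  "subcomplex T S \<longleftrightarrow> T \<subseteq> S \<and> simplicial_complex T"

definition complex_dim :: "'a::euclidean_space set set \<Rightarrow> int" where
  "complex_dim S = Max (aff_dim ` S)"

definition face_count :: "nat \<Rightarrow> 'a::euclidean_space set set \<Rightarrow> nat" where
  "face_count i S = card {\<sigma> \<in> S. int i simplex \<sigma>}"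

definition euler_char :: "'a::euclidean_space set set \<Rightarrow> int" where
  "euler_char S = (\<Sum>i\<le>nat (complex_dim S). (-1) ^ i * int (face_count i S))"

definition vertex_density :: "nat \<Rightarrow> 'a::euclidean_space set set \<Rightarrow> ereal" where
  "vertex_density i T = (if face_count i T = 0 then \<infinity>
                  else ereal (real (face_count 0 T) / real (face_count i T)))"

text \<open>Points of $r$-dimensional real space are extensional functions on \<open>{1..r}\<close>. Division in
  \<^typ>\<open>ereal\<close> satisfies \<open>a / \<infinity> = 0\<close> for finite \<open>a\<close>.\<close>

definition density_domain :: "nat \<Rightarrow> 'a::euclidean_space set set \<Rightarrow> (nat \<Rightarrow> real) set" where
  "density_domain r T =
     {\<alpha> \<in> {1..r} \<rightarrow>\<^sub>E UNIV.
        (\<forall>i\<in>{1..r}. 0 \<le> \<alpha> i) \<and> (\<Sum>i=1..r. ereal (\<alpha> i) / vertex_density i T) < 1}"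

definition reduced_density_domain :: "nat \<Rightarrow> 'a::euclidean_space set set \<Rightarrow> (nat \<Rightarrow> real) set" where
  "reduced_density_domain r S = (\<Inter>T \<in> {T. subcomplex T S \<and> \<Union>T \<noteq> {}}. density_domain r T)"

definition balanced :: "nat \<Rightarrow> 'a::euclidean_space set set \<Rightarrow> bool" where
  "balanced r S \<longleftrightarrow>
     simplicial_complex S \<and> complex_dim S = int r \<and>
     reduced_density_domain r S = density_domain r S"

end

theory Submission
  imports Defs "HOL-Homology.Invariance_of_Domain"
begin

text \<open>
Write \<open>f\<^sub>0, f\<^sub>1, f\<^sub>2\<close> for the face numbers of the triangulated surface \<open>S\<close>, and \<open>v, e, t\<close> for those
of a nonempty subcomplex \<open>T\<close>. It suffices that both densities of \<open>T\<close> are at most those of \<open>S\<close>: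
\<open>e / v \<le> f\<^sub>1 / f\<^sub>0\<close> and \<open>t / v \<le> f\<^sub>2 / f\<^sub>0\<close>. As every edge of \<open>S\<close> lies in exactly two triangles, \<open>3 f\<^sub>2 = 2 f\<^sub>1\<close>
and \<open>3 t \<le> 2 e\<close>, so the second inequality follows from the first.

The first one rests on \<open>e \<le> 3 v - 3 \<chi>\<close> for \<open>e \<ge> 2\<close> (lemma \<open>edge_bound\<close>). Since
\<open>f\<^sub>1 = 3 f\<^sub>0 - 3 \<chi>\<close>, and \<open>v \<le> f\<^sub>0\<close>, \<open>\<chi> \<ge> 0\<close>, this yields \<open>e f\<^sub>0 \<le> f\<^sub>1 v\<close>.
The bound is the usual one for a simple graph embedded in a surface, with faces that are defined
combinatorially. Join every vertex outside \<open>T\<close> to \<open>T\<close> by a forest of \<open>f\<^sub>0 - v\<close> edges of \<open>S\<close>, and glue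
triangles along each of the \<open>f\<^sub>1 - e - (f\<^sub>0 - v)\<close> remaining edges; each gluing lowers the number of
pieces by at most one, so at least \<open>f\<^sub>2 - f\<^sub>1 + e + f\<^sub>0 - v = \<chi> + e - v\<close> pieces result. The boundary
modulo 2 of a piece has even degree everywhere, hence contains no edge of the forest, hence
consists of edges of \<open>T\<close>. If it is nonempty, it has at least three edges; it is empty only if the entire
surface is the only piece. In both cases \<open>3 (\<chi> + e - v) \<le> 2 e\<close>, as every edge of \<open>T\<close> has two sides and \<open>e \<ge> 2\<close>.

The topological part extracts from the homeomorphism with a surface what the counting uses:
the complex is pure of dimension 2, every edge lies in exactly two triangles, and any two triangles
are linked by a chain of triangles with common edges. The first two follow from
invariance of domain, applied in both directions between charts and open pieces of the complex.
The third holds because a small disc around a vertex stays connected when the vertex is removed.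
\<close>

section \<open>Edges of a subgraph of a closed triangulation\<close>

text \<open>Starting from singletons, treat the links one after the other and merge the two blocks that a link
meets; each link costs at most one block. The number of connected components of a graph is thus at
least the number of vertices minus the number of edges.\<close>

lemma partition_merging:
  fixes l r :: "'i \<Rightarrow> 'x"
  assumes "finite A" "finite X" "\<And>a. a \<in> A \<Longrightarrow> l a \<in> X \<and> r a \<in> X"
  shows "\<exists>P. partition_on X P \<and> (\<forall>a\<in>A. \<exists>B\<in>P. l a \<in> B \<and> r a \<in> B) \<and> card X \<le> card P + card A"
  using assms(1,3)
proof (induction A rule: finite_induct)
  case empty
  have "partition_on X ((\<lambda>x. {x}) ` X)"
    by (auto simp: partition_on_def disjoint_def)
  moreover have "card ((\<lambda>x. {x}) ` X) = card X"
    by (simp add: card_image)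
  ultimately show ?case by fastforce
next
  case (insert a A)
  then obtain P where P: "partition_on X P" "\<forall>a\<in>A. \<exists>B\<in>P. l a \<in> B \<and> r a \<in> B"
      "card X \<le> card P + card A"
    by auto
  obtain B where B: "B \<in> P" "l a \<in> B"
    using P(1) insert.prems by (auto simp: partition_on_def)
  obtain C where C: "C \<in> P" "r a \<in> C"
    using P(1) insert.prems by (auto simp: partition_on_def)
  define Q where "Q = insert (B \<union> C) (P - {B, C})"
  have "finite P"
    using P(1) assms(2) finite_elements by blast
  have "partition_on X Q"
  proof (rule partition_onI)
    show "\<Union>Q = X"
      using B(1) C(1) partition_onD1[OF P(1)] by (auto simp: Q_def)
    show "{} \<notin> Q"
      using B(2) partition_onD3[OF P(1)] by (auto simp: Q_def)
    have "disjnt D D'" if "D \<in> P" "D' \<in> P" "D \<noteq> D'" for D D'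
      using partition_onD2[OF P(1)] that by (auto simp: disjoint_def disjnt_def)
    note disj = this
    have BC: "disjnt (B \<union> C) D" if "D \<in> P - {B, C}" for D
      using that B(1) C(1) disj[of B D] disj[of C D] by (auto simp: disjnt_Un1)
    show "disjnt D D'" if Q: "D \<in> Q" "D' \<in> Q" "D \<noteq> D'" for D D'
    proof -
      consider "D = B \<union> C" "D' \<in> P - {B, C}" | "D' = B \<union> C" "D \<in> P - {B, C}"
        | "D \<in> P" "D' \<in> P"
        using Q unfolding Q_def by blast
      then show ?thesis
        by cases (use BC disj disjnt_sym \<open>D \<noteq> D'\<close> in metis)+
    qed
  qed
  moreover have "\<forall>b\<in>insert a A. \<exists>D\<in>Q. l b \<in> D \<and> r b \<in> D"
  proof
    fix b assume b: "b \<in> insert a A"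
    have BC: "B \<union> C \<in> Q" by (simp add: Q_def)
    show "\<exists>D\<in>Q. l b \<in> D \<and> r b \<in> D"
    proof (cases "b = a")
      case True
      then show ?thesis using B(2) C(2) BC by (intro bexI[of _ "B \<union> C"]) simp_all
    next
      case False
      then obtain D where D: "D \<in> P" "l b \<in> D \<and> r b \<in> D"
        using P(2) b by (meson insertE)
      show ?thesis
      proof (cases "D = B \<or> D = C")
        case True
        then show ?thesis using D(2) BC by (intro bexI[of _ "B \<union> C"]) auto
      next
        case False
        then show ?thesis using D by (intro bexI[of _ D]) (simp_all add: Q_def)
      qed
    qed
  qed
  moreover have "card P \<le> card Q + 1"
  proof -
    have two: "card (insert B (insert C R)) \<le> Suc (Suc (card R))" if "finite R" for R
      using that by (simp add: card_insert_if)
    have "card P \<le> card (insert B (insert C (P - {B, C})))"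
      using \<open>finite P\<close> by (intro card_mono) auto
    also have "\<dots> \<le> Suc (Suc (card (P - {B, C})))"
      using \<open>finite P\<close> by (intro two) simp
    finally have le: "card P \<le> Suc (Suc (card (P - {B, C})))" .
    have "B \<union> C \<notin> P - {B, C}"
    proof
      assume *: "B \<union> C \<in> P - {B, C}"
      then have "(B \<union> C) \<inter> B = {}"
        using disjointD[OF partition_onD2[OF P(1)], of "B \<union> C" B] B(1) by simp
      then show False using B by blast
    qed
    then have "card Q = Suc (card (P - {B, C}))"
      by (simp add: Q_def \<open>finite P\<close>)
    with le show ?thesis by simp
  qed
  ultimately show ?case
    using P(3) insert.hyps by (intro exI[of _ Q]) auto
qed

lemma double_count:
  assumes "finite A" "finite B"
  shows "(\<Sum>a\<in>A. card {b\<in>B. R a b}) = (\<Sum>b\<in>B. card {a\<in>A. R a b})"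
proof -
  have "(\<Sum>a\<in>A. card {b\<in>B. R a b}) = (\<Sum>a\<in>A. \<Sum>b\<in>{b\<in>B. R a b}. 1)"
    by simp
  also have "\<dots> = (\<Sum>b\<in>B. \<Sum>a\<in>{a\<in>A. R a b}. 1)"
    using assms by (rule sum.swap_restrict)
  finally show ?thesis by simp
qed

text \<open>Combinatorial closed surfaces. Strong connectivity, the linking of any two triangles by a chain with common
edges, is phrased as an induction principle for sets of triangles: this is the form in which connectedness
of the surface proves it, and in which it applies to the pieces of a partition.\<close>

locale closed_triangulation =
  fixes V :: "'v set" and E F :: "'v set set"
  assumes finite_V: "finite V"
    and edge: "e \<in> E \<Longrightarrow> e \<subseteq> V \<and> card e = 2"
    and triangle: "f \<in> F \<Longrightarrow> f \<subseteq> V \<and> card f = 3"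
    and edge_of_triangle: "f \<in> F \<Longrightarrow> e \<subseteq> f \<Longrightarrow> card e = 2 \<Longrightarrow> e \<in> E"
    and two_triangles: "e \<in> E \<Longrightarrow> card {f\<in>F. e \<subseteq> f} = 2"
    and covered: "v \<in> V \<Longrightarrow> \<exists>f\<in>F. v \<in> f"
    and strongly_connected: "\<lbrakk>D \<subseteq> F; D \<noteq> {};
          \<And>e f g. \<lbrakk>f \<in> D; g \<in> F; e \<in> E; e \<subseteq> f; e \<subseteq> g\<rbrakk> \<Longrightarrow> g \<in> D\<rbrakk> \<Longrightarrow> D = F"
begin

lemma edge_ends:
  assumes "e \<in> E" "x \<in> e"
  obtains y where "e = {x, y}" "x \<noteq> y"
proof -
  obtain a b where "e = {a, b}" "a \<noteq> b"
    using edge[OF assms(1)] card_2_iff by metis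
  then show thesis using assms(2) that[of a] that[of b] by fastforce
qed

lemma finite_E: "finite E"
  using finite_V edge by (intro finite_subset[of E "Pow V"]) auto

lemma finite_F: "finite F"
  using finite_V triangle by (intro finite_subset[of F "Pow V"]) auto

lemma card_edges_of_triangle:
  assumes "f \<in> F"
  shows "card {e\<in>E. e \<subseteq> f} = 3"
proof -
  have "{e\<in>E. e \<subseteq> f} = {e. e \<subseteq> f \<and> card e = 2}"
    using assms edge edge_of_triangle by auto
  moreover have "finite f"
    using assms triangle finite_subset[OF _ finite_V] by auto
  ultimately show ?thesis
    using n_subsets[of f 2] triangle[OF assms] by (simp add: choose_two)
qed

lemma triangles_le_edges:
  assumes "E' \<subseteq> E" "F' \<subseteq> F" "\<And>e f. \<lbrakk>f \<in> F'; e \<in> E; e \<subseteq> f\<rbrakk> \<Longrightarrow> e \<in> E'"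
  shows "3 * card F' \<le> 2 * card E'"
proof -
  have fin: "finite E'" "finite F'"
    using assms(1,2) finite_subset[OF _ finite_E] finite_subset[OF _ finite_F] by auto
  have "{e\<in>E'. e \<subseteq> f} = {e\<in>E. e \<subseteq> f}" if "f \<in> F'" for f
    using that assms by blast
  then have "(\<Sum>f\<in>F'. card {e\<in>E'. e \<subseteq> f}) = 3 * card F'"
    using assms(2) card_edges_of_triangle by (simp add: subset_iff)
  moreover have "(\<Sum>f\<in>F'. card {e\<in>E'. e \<subseteq> f}) = (\<Sum>e\<in>E'. card {f\<in>F'. e \<subseteq> f})"
    using fin by (intro double_count)
  moreover have "(\<Sum>e\<in>E'. card {f\<in>F'. e \<subseteq> f}) \<le> (\<Sum>e\<in>E'. 2)"
  proof (rule sum_mono)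
    fix e assume "e \<in> E'"
    have "card {f\<in>F'. e \<subseteq> f} \<le> card {f\<in>F. e \<subseteq> f}"
      using assms(2) finite_F by (intro card_mono) auto
    then show "card {f\<in>F'. e \<subseteq> f} \<le> 2"
      using \<open>e \<in> E'\<close> assms(1) two_triangles by auto
  qed
  ultimately show ?thesis by (simp add: mult.commute)
qed

lemma three_triangles_eq_two_edges: "3 * card F = 2 * card E"
proof -
  have "3 * card F = (\<Sum>f\<in>F. card {e\<in>E. e \<subseteq> f})"
    using card_edges_of_triangle by simp
  also have "\<dots> = (\<Sum>e\<in>E. card {f\<in>F. e \<subseteq> f})"
    using finite_E finite_F by (intro double_count)
  finally show ?thesis using two_triangles by simp
qed

lemma vertex_on_edge:
  assumes "v \<in> V"
  shows "\<exists>e\<in>E. v \<in> e"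
proof -
  obtain f where f: "f \<in> F" "v \<in> f" using assms covered by blast
  then have "f \<noteq> {v}" using triangle by fastforce
  then obtain w where "w \<in> f" "w \<noteq> v" using f by blast
  then have "{v, w} \<in> E"
    using f by (intro edge_of_triangle) auto
  then show ?thesis by blast
qed

lemma card_V_le: "card V \<le> 2 * card E"
proof -
  have "V \<subseteq> \<Union>E" using vertex_on_edge by blast
  moreover have "finite (\<Union>E)"
    using edge finite_subset[OF _ finite_V] by (meson Union_least)
  ultimately have "card V \<le> card (\<Union>E)" by (rule card_mono[rotated])
  also have "\<dots> \<le> (\<Sum>e\<in>E. card e)" by (rule card_Union_le_sum_card)
  also have "\<dots> = 2 * card E" using edge by simp
  finally show ?thesis .
qed

text \<open>Strong connectivity passes to the 1-skeleton: the triangles that meet a set of vertices closed under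
adjacency form a set closed under passing to neighbours.\<close>

lemma vertices_connected:
  assumes "W \<subseteq> V" "W \<noteq> {}" "\<And>x y. x \<in> W \<Longrightarrow> {x, y} \<in> E \<Longrightarrow> y \<in> W"
  shows "W = V"
proof -
  have all: "f \<subseteq> W" if "f \<in> F" "f \<inter> W \<noteq> {}" for f
  proof
    fix y assume "y \<in> f"
    obtain x where "x \<in> f" "x \<in> W" using \<open>f \<inter> W \<noteq> {}\<close> by blast
    show "y \<in> W"
    proof (cases "x = y")
      case False
      then have "{x, y} \<in> E"
        using \<open>f \<in> F\<close> \<open>x \<in> f\<close> \<open>y \<in> f\<close> by (intro edge_of_triangle) auto
      with \<open>x \<in> W\<close> assms(3) show ?thesis by blast
    qed (use \<open>x \<in> W\<close> in simp)
  qed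
  define D where "D = {f\<in>F. f \<inter> W \<noteq> {}}"
  have "D = F"
  proof (rule strongly_connected)
    show "D \<noteq> {}"
      using assms(1,2) covered by (fastforce simp: D_def)
    show "g \<in> D" if "f \<in> D" "g \<in> F" "e \<in> E" "e \<subseteq> f" "e \<subseteq> g" for e f g
    proof -
      have "e \<noteq> {}" using edge[OF \<open>e \<in> E\<close>] by auto
      moreover have "f \<subseteq> W" using that all by (auto simp: D_def)
      ultimately show ?thesis using that by (auto simp: D_def)
    qed
  qed (auto simp: D_def)
  have "v \<in> W" if "v \<in> V" for v
  proof -
    from covered[OF that] obtain f where "f \<in> F" "v \<in> f" by blast
    moreover from this \<open>D = F\<close> have "f \<inter> W \<noteq> {}" by (auto simp: D_def)
    ultimately show ?thesis using all by blast
  qed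
  with assms(1) show ?thesis by blast
qed

text \<open>Distance to \<open>V'\<close> and a step along a shortest path. The edges \<open>{u, p u}\<close> form the forest that
connects all other vertices to \<open>V'\<close>.\<close>

lemma descent:
  assumes "V' \<subseteq> V" "V' \<noteq> {}"
  obtains d :: "'v \<Rightarrow> nat" and p :: "'v \<Rightarrow> 'v"
  where "\<And>u. u \<in> V - V' \<Longrightarrow> {u, p u} \<in> E \<and> d (p u) < d u"
proof -
  define R where "R = {(x, y). {x, y} \<in> E}"
  define reach where "reach u n \<longleftrightarrow> (\<exists>w\<in>V'. (w, u) \<in> R ^^ n)" for u n
  define d where "d u = (LEAST n. reach u n)" for u
  have "{u \<in> V. \<exists>n. reach u n} = V"
  proof (rule vertices_connected)
    have "reach w 0" if "w \<in> V'" for w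
      using that by (auto simp: reach_def)
    then show "{u \<in> V. \<exists>n. reach u n} \<noteq> {}"
      using assms by blast
    show "y \<in> {u \<in> V. \<exists>n. reach u n}" if x: "x \<in> {u \<in> V. \<exists>n. reach u n}" and "{x, y} \<in> E" for x y
    proof -
      obtain n w where "w \<in> V'" "(w, x) \<in> R ^^ n"
        using x unfolding reach_def by blast
      moreover have "(x, y) \<in> R" using \<open>{x, y} \<in> E\<close> by (simp add: R_def)
      ultimately have "(w, y) \<in> R ^^ Suc n" by (blast intro: relpow_Suc_I)
      then show ?thesis using \<open>w \<in> V'\<close> edge[OF \<open>{x, y} \<in> E\<close>]
        unfolding reach_def by blast
    qed
  qed auto
  then have reached: "reach u (d u)" if "u \<in> V" for u
  proof -
    have "\<exists>n. reach u n" using \<open>{u \<in> V. \<exists>n. reach u n} = V\<close> that by blast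
    then show ?thesis unfolding d_def by (rule LeastI_ex)
  qed
  have "\<exists>q. {u, q} \<in> E \<and> d q < d u" if u: "u \<in> V - V'" for u
  proof -
    obtain w where w: "w \<in> V'" "(w, u) \<in> R ^^ d u"
      using reached[of u] u unfolding reach_def by blast
    have "d u \<noteq> 0"
    proof
      assume "d u = 0"
      with w(2) have "w = u" by simp
      with w(1) u show False by simp
    qed
    then obtain n where n: "d u = Suc n" by (cases "d u") auto
    then obtain q where q: "(w, q) \<in> R ^^ n" "(q, u) \<in> R"
      using w(2) by auto
    then have "d q \<le> n"
      unfolding d_def reach_def using w(1) by (auto intro: Least_le)
    then show ?thesis using q(2) n by (auto simp: R_def insert_commute)
  qed
  then have "\<forall>u. \<exists>q. u \<in> V - V' \<longrightarrow> {u, q} \<in> E \<and> d q < d u" by blast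
  then obtain p where "\<forall>u. u \<in> V - V' \<longrightarrow> {u, p u} \<in> E \<and> d (p u) < d u"
    by metis
  then show ?thesis using that by blast
qed

text \<open>The boundary of \<open>D\<close> as a chain modulo 2: an edge lies in at most two triangles of \<open>D\<close>, so being in an odd
number of them means being in exactly one.\<close>

definition bdry :: "'v set set \<Rightarrow> 'v set set" where
  "bdry D = {e\<in>E. card {f\<in>D. e \<subseteq> f} = 1}"

text \<open>A boundary is a cycle: counting pairs of an edge at \<open>x\<close> and a triangle of \<open>D\<close> that contains it
gives two pairs for each triangle at \<open>x\<close>.\<close>

lemma bdry_even:
  assumes "D \<subseteq> F"
  shows "even (card {e\<in>bdry D. x \<in> e})"
proof -
  have finD: "finite D" by (rule finite_subset[OF assms finite_F])
  let ?X = "{e\<in>E. x \<in> e}"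
  have two: "card {e\<in>?X. e \<subseteq> f} = (if x \<in> f then 2 else 0)" if "f \<in> D" for f
  proof (cases "x \<in> f")
    case True
    have f: "f \<in> F" using that assms by blast
    have "{e\<in>?X. e \<subseteq> f} = (\<lambda>y. {x, y}) ` (f - {x})"
    proof (intro equalityI subsetI)
      fix e assume "e \<in> {e\<in>?X. e \<subseteq> f}"
      then have e: "e \<in> E" "x \<in> e" "e \<subseteq> f" by auto
      obtain y where "e = {x, y}" "x \<noteq> y"
        by (rule edge_ends[OF e(1,2)])
      with e(3) show "e \<in> (\<lambda>y. {x, y}) ` (f - {x})"
        by (intro image_eqI[of _ _ y]) auto
    next
      fix e assume "e \<in> (\<lambda>y. {x, y}) ` (f - {x})"
      then obtain y where y: "e = {x, y}" "y \<in> f" "y \<noteq> x" by auto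
      then have "e \<in> E"
        using True f by (intro edge_of_triangle) auto
      with y True show "e \<in> {e\<in>?X. e \<subseteq> f}" by auto
    qed
    moreover have "inj_on (\<lambda>y. {x, y}) (f - {x})"
      by (auto simp: inj_on_def doubleton_eq_iff)
    ultimately have "card {e\<in>?X. e \<subseteq> f} = card (f - {x})"
      by (simp add: card_image)
    also have "\<dots> = 2"
      using triangle[OF f] True by (simp add: card_Diff_singleton)
    finally show ?thesis using True by simp
  next
    case False
    then have "{e\<in>?X. e \<subseteq> f} = {}" by auto
    then show ?thesis using False by (metis card.empty)
  qed
  have "(\<Sum>e\<in>?X. card {f\<in>D. e \<subseteq> f}) = (\<Sum>f\<in>D. card {e\<in>?X. e \<subseteq> f})"
    using finite_E finD by (intro double_count) auto
  also have "even \<dots>"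
    using two by (intro dvd_sum) auto
  finally have "even (card {e\<in>?X. odd (card {f\<in>D. e \<subseteq> f})})"
    using finite_E by (subst (asm) even_sum_iff) auto
  moreover have "odd (card {f\<in>D. e \<subseteq> f}) \<longleftrightarrow> card {f\<in>D. e \<subseteq> f} = 1" if "e \<in> E" for e
  proof -
    have "card {f\<in>D. e \<subseteq> f} \<le> card {f\<in>F. e \<subseteq> f}"
      using assms finite_F by (intro card_mono) auto
    then have "card {f\<in>D. e \<subseteq> f} \<le> 2" using two_triangles that by simp
    then have "card {f\<in>D. e \<subseteq> f} \<in> {0, 1, 2}" by auto
    then show ?thesis by auto
  qed
  then have "{e\<in>?X. odd (card {f\<in>D. e \<subseteq> f})} = {e\<in>bdry D. x \<in> e}"
    unfolding bdry_def by auto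
  ultimately show ?thesis by simp
qed

lemma bdry_continue:
  assumes "D \<subseteq> F" "e \<in> bdry D" "x \<in> e"
  obtains e' where "e' \<in> bdry D" "x \<in> e'" "e' \<noteq> e"
proof -
  have "{e'\<in>bdry D. x \<in> e'} \<noteq> {e}"
  proof
    assume "{e'\<in>bdry D. x \<in> e'} = {e}"
    then have "card {e'\<in>bdry D. x \<in> e'} = 1" by simp
    with bdry_even[OF assms(1), of x] show False by simp
  qed
  moreover have "e \<in> {e'\<in>bdry D. x \<in> e'}"
    using assms(2,3) by simp
  ultimately have "\<exists>e'. e' \<in> {e'\<in>bdry D. x \<in> e'} \<and> e' \<noteq> e" by auto
  then show ?thesis using that by auto
qed

lemma bdry_nonempty:
  assumes "D \<subseteq> F" "D \<noteq> {}" "D \<noteq> F"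
  shows "bdry D \<noteq> {}"
proof -
  have "\<exists>e f g. f \<in> D \<and> g \<in> F \<and> g \<notin> D \<and> e \<in> E \<and> e \<subseteq> f \<and> e \<subseteq> g"
    using strongly_connected[OF assms(1,2)] assms(3) by blast
  then obtain e f g where *: "f \<in> D" "g \<in> F" "g \<notin> D" "e \<in> E" "e \<subseteq> f" "e \<subseteq> g"
    by blast
  have "card {h\<in>D. e \<subseteq> h} < card {h\<in>F. e \<subseteq> h}"
    using * assms(1) finite_F by (intro psubset_card_mono) auto
  moreover have "card {h\<in>D. e \<subseteq> h} \<noteq> 0"
  proof -
    have "finite {h\<in>D. e \<subseteq> h}" using finite_subset[OF assms(1) finite_F] by simp
    then show ?thesis using *(1,5) by (auto simp: card_eq_0_iff)
  qed
  ultimately have "e \<in> bdry D"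
    using two_triangles[OF \<open>e \<in> E\<close>] * by (auto simp: bdry_def)
  then show ?thesis by blast
qed

text \<open>Euler's inequality for embedded graphs. The threshold on \<open>card E'\<close> is needed for the piece that is
the entire surface: it has no boundary, and \<open>2 * card E' \<ge> 3\<close> replaces the count of its boundary edges.\<close>

lemma edge_bound:
  assumes V': "V' \<subseteq> V" and E': "E' \<subseteq> E" "E' \<subseteq> Pow V'" "2 \<le> card E'"
  shows "int (card E') \<le> 3 * int (card V') - 3 * (int (card V) - int (card E) + int (card F))"
proof -
  have finE': "finite E'" by (rule finite_subset[OF E'(1) finite_E])
  have "E' \<noteq> {}" using E'(3) by auto
  then obtain e0 where "e0 \<in> E'" by blast
  then have "V' \<noteq> {}" using E' edge by fastforce
  then obtain d :: "'v \<Rightarrow> nat" and p where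
    p: "\<And>u. u \<in> V - V' \<Longrightarrow> {u, p u} \<in> E \<and> d (p u) < d u"
    using descent[OF V'] by blast
  define H where "H = (\<lambda>u. {u, p u}) ` (V - V')"
  have "inj_on (\<lambda>u. {u, p u}) (V - V')"
  proof (rule inj_onI)
    fix u w assume "u \<in> V - V'" "w \<in> V - V'" "{u, p u} = {w, p w}"
    then show "u = w"
      using p[of u] p[of w] by (auto simp: doubleton_eq_iff)
  qed
  then have cardH: "card H = card V - card V'"
    using V' finite_V by (simp add: H_def card_image card_Diff_subset finite_subset)
  have HE: "H \<subseteq> E" using p by (auto simp: H_def)
  have disj: "E' \<inter> H = {}" using E'(2) by (auto simp: H_def)
  \<comment> \<open>triangles are glued along the edges of \<open>A\<close>\<close>
  define A where "A = E - (E' \<union> H)"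
  have finA: "finite A" using finite_E by (simp add: A_def)
  have "card A = card E - (card E' + card H)"
    unfolding A_def using E'(1) HE disj finE' finite_E
    by (simp add: card_Diff_subset card_Un_disjoint finite_subset)
  moreover have "card E' + card H \<le> card E"
    using E'(1) HE disj finE' finite_E
    by (metis card_Un_disjoint card_mono finite_subset le_sup_iff)
  ultimately have cardA: "card A + card E' + card V = card E + card V'"
    using cardH V' finite_V card_mono[OF finite_V V'] by linarith
  have "\<forall>e\<in>E. \<exists>f g. {h\<in>F. e \<subseteq> h} = {f, g}"
    using two_triangles by (meson card_2_iff)
  then obtain l r where lr: "\<And>e. e \<in> E \<Longrightarrow> {h\<in>F. e \<subseteq> h} = {l e, r e}"
    by metis
  have "l a \<in> F \<and> r a \<in> F" if "a \<in> A" for a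
    using lr[of a] that by (auto simp: A_def)
  then obtain P where P: "partition_on F P" "\<forall>a\<in>A. \<exists>B\<in>P. l a \<in> B \<and> r a \<in> B"
      "card F \<le> card P + card A"
    using partition_merging[OF finA finite_F, of l r] by blast
  have bdry: "bdry D \<subseteq> E' \<union> H" if "D \<in> P" for D
  proof
    fix e assume e: "e \<in> bdry D"
    then have eE: "e \<in> E" and one: "card {f\<in>D. e \<subseteq> f} = 1" by (auto simp: bdry_def)
    show "e \<in> E' \<union> H"
    proof (rule ccontr)
      assume "e \<notin> E' \<union> H"
      then have "e \<in> A" using eE by (simp add: A_def)
      then obtain B where B: "B \<in> P" "l e \<in> B" "r e \<in> B" using P(2) by blast
      obtain f where f: "f \<in> D" "e \<subseteq> f"
        using one by (metis (no_types, lifting) card_1_singletonE insertI1 mem_Collect_eq)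
      have "D \<subseteq> F" using P(1) that by (auto simp: partition_on_def)
      then have "f = l e \<or> f = r e"
        using f lr[OF eE] by blast
      then have "f \<in> B" using B by blast
      then have "B = D"
        using disjointD[OF partition_onD2[OF P(1)] B(1) that] f(1) by blast
      then have "{f\<in>F. e \<subseteq> f} \<subseteq> D"
        using lr[OF eE] B by simp
      then have "{f\<in>D. e \<subseteq> f} = {f\<in>F. e \<subseteq> f}"
        using \<open>D \<subseteq> F\<close> by auto
      then show False using one two_triangles[OF eE] by simp
    qed
  qed
  \<comment> \<open>a forest edge of the boundary that is farthest from \<open>V'\<close> could not be continued outwards\<close>
  have no_tree: "bdry D \<subseteq> E'" if DP: "D \<in> P" for D
  proof -
    have DF: "D \<subseteq> F" using P(1) that by (auto simp: partition_on_def)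
    define U where "U = {u \<in> V - V'. {u, p u} \<in> bdry D}"
    have "U = {}"
    proof (rule ccontr)
      assume "U \<noteq> {}"
      have "finite U" using finite_V by (simp add: U_def)
      with \<open>U \<noteq> {}\<close> have "Max (d ` U) \<in> d ` U" by simp
      then obtain u where u: "u \<in> U" "d u = Max (d ` U)" by auto
      have max: "d w \<le> d u" if "w \<in> U" for w
        using that u(2) \<open>finite U\<close> by simp
      obtain e where e: "e \<in> bdry D" "u \<in> e" "e \<noteq> {u, p u}"
        using u(1)
          bdry_continue[OF DF, of "{u, p u}" u] by (auto simp: U_def)
      have "e \<notin> E'" using e(2) u(1) E'(2) by (auto simp: U_def)
      then obtain w where w: "w \<in> V - V'" "e = {w, p w}"
        using bdry[OF DP] e(1) by (auto simp: H_def)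
      then have "u = p w" using e by auto
      then have "d u < d w" using p w(1) by blast
      moreover have "w \<in> U" using w e(1) by (simp add: U_def)
      ultimately show False using max by fastforce
    qed
    then show ?thesis
      using bdry[OF that] by (auto simp: H_def U_def)
  qed
  \<comment> \<open>a boundary edge is continued at both of its ends, by distinct edges\<close>
  have three: "3 \<le> (\<Sum>f\<in>D. card {e\<in>E'. e \<subseteq> f})" if "D \<in> P" for D
  proof -
    have DF: "D \<subseteq> F" "D \<noteq> {}" using P(1) that by (auto simp: partition_on_def)
    have finD: "finite D" by (rule finite_subset[OF DF(1) finite_F])
    have eq: "(\<Sum>f\<in>D. card {e\<in>E'. e \<subseteq> f}) = (\<Sum>e\<in>E'. card {f\<in>D. e \<subseteq> f})"
      using finD finE' by (intro double_count)
    show ?thesis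
    proof (cases "D = F")
      case True
      then have "(\<Sum>e\<in>E'. card {f\<in>D. e \<subseteq> f}) = 2 * card E'"
        using E'(1) two_triangles by (simp add: subset_iff)
      then show ?thesis using eq E'(3) by simp
    next
      case False
      have B: "bdry D \<subseteq> E'" using no_tree[OF that] .
      obtain e where e: "e \<in> bdry D" using bdry_nonempty[OF DF False] by blast
      then have "card e = 2" using edge by (auto simp: bdry_def)
      then obtain x y where xy: "e = {x, y}" "x \<noteq> y" using card_2_iff[of e] by blast
      obtain e1 where e1: "e1 \<in> bdry D" "x \<in> e1" "e1 \<noteq> e"
        by (rule bdry_continue[OF DF(1) e, of x]) (simp_all add: xy(1))
      obtain e2 where e2: "e2 \<in> bdry D" "y \<in> e2" "e2 \<noteq> e"
        by (rule bdry_continue[OF DF(1) e, of y]) (simp_all add: xy(1))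
      have "y \<notin> e1"
      proof
        assume "y \<in> e1"
        then have "e \<subseteq> e1" using xy e1 by auto
        moreover have "card e1 = 2" "finite e1"
          using e1(1) edge finite_subset[OF _ finite_V] by (auto simp: bdry_def)
        ultimately show False using e1(3) \<open>card e = 2\<close> card_subset_eq by metis
      qed
      then have "e1 \<noteq> e2" using e2 by blast
      then have "3 = card {e, e1, e2}" using e1 e2 by simp
      also have "\<dots> \<le> card (bdry D)"
        using e e1 e2 finite_subset[OF B finE'] by (intro card_mono) auto
      also have "\<dots> = (\<Sum>e\<in>bdry D. card {f\<in>D. e \<subseteq> f})"
        by (simp add: bdry_def)
      also have "\<dots> \<le> (\<Sum>e\<in>E'. card {f\<in>D. e \<subseteq> f})"
        using B finE' by (intro sum_mono2) auto
      finally show ?thesis using eq by simp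
    qed
  qed
  have "finite P" using P(1) finite_F finite_elements by blast
  have "3 * card P \<le> (\<Sum>D\<in>P. \<Sum>f\<in>D. card {e\<in>E'. e \<subseteq> f})"
    using sum_mono[of P "\<lambda>_. 3", OF three] by (simp add: mult.commute)
  also have "\<dots> = (\<Sum>f\<in>F. card {e\<in>E'. e \<subseteq> f})"
  proof -
    have F: "F = \<Union>P" by (rule partition_onD1[OF P(1)])
    have "\<forall>D\<in>P. finite D"
      using F finite_subset[OF _ finite_F] by auto
    moreover have "\<forall>A\<in>P. \<forall>B\<in>P. A \<noteq> B \<longrightarrow> A \<inter> B = {}"
      using disjointD[OF partition_onD2[OF P(1)]] by simp
    ultimately show ?thesis
      using sum.Union_disjoint[of P "\<lambda>f. card {e\<in>E'. e \<subseteq> f}"] F by simp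
  qed
  also have "\<dots> = (\<Sum>e\<in>E'. card {f\<in>F. e \<subseteq> f})"
    using finite_F finE' by (intro double_count)
  also have "\<dots> = 2 * card E'"
    using E'(1) two_triangles by (simp add: subset_iff)
  finally have "3 * card P \<le> 2 * card E'" .
  moreover have "3 * card E' + 3 * card V + 3 * card F \<le> 3 * card E + 3 * card V' + 3 * card P"
    using P(3) cardA by linarith
  ultimately have "card E' + 3 * card V + 3 * card F \<le> 3 * card E + 3 * card V'"
    by linarith
  then have "int (card E' + 3 * card V + 3 * card F) \<le> int (3 * card E + 3 * card V')"
    by (simp only: of_nat_le_iff)
  then show ?thesis by simp
qed

text \<open>Below two edges the inequality \<open>edge_bound\<close> can fail (a single vertex of a sphere), but there the
densities are tiny: \<open>card V \<le> 2 * card E\<close> suffices.\<close>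

lemma edge_density:
  assumes V': "V' \<subseteq> V" "V' \<noteq> {}" and E': "E' \<subseteq> E" "E' \<subseteq> Pow V'"
    and chi: "0 \<le> int (card V) - int (card E) + int (card F)"
  shows "card E' * card V \<le> card E * card V'"
proof -
  define c where "c = int (card V) - int (card E) + int (card F)"
  have finV': "finite V'" by (rule finite_subset[OF V'(1) finite_V])
  consider "card E' = 0" | "card E' = 1" | "2 \<le> card E'" by linarith
  then show ?thesis
  proof cases
    case 2
    then obtain e where "e \<in> E'" by (metis card_1_singletonE insertI1)
    then have "card e = 2" "e \<subseteq> V'" using E' edge by auto
    then have "2 \<le> card V'" using finV' card_mono by metis
    then have "card E * 2 \<le> card E * card V'" by (rule mult_le_mono2)
    then have "card V \<le> card E * card V'" using card_V_le by linarith
    then show ?thesis using 2 by simp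
  next
    case 3
    have "int (card E) = 3 * int (card V) - 3 * c"
      using arg_cong[OF three_triangles_eq_two_edges, of int] by (simp add: c_def)
    then have "int (card E) * int (card V') = (3 * int (card V) - 3 * c) * int (card V')"
      by simp
    then have "int (card E) * int (card V') = 3 * int (card V) * int (card V') - 3 * (c * int (card V'))"
      by (simp add: left_diff_distrib)
    moreover have "int (card E') * int (card V) \<le> (3 * int (card V') - 3 * c) * int (card V)"
      using edge_bound[OF V'(1) E' 3] by (intro mult_right_mono) (simp_all add: c_def)
    then have "int (card E') * int (card V) \<le> 3 * int (card V) * int (card V') - 3 * (c * int (card V))"
      by (simp add: algebra_simps)
    moreover have "c * int (card V') \<le> c * int (card V)"
      using chi card_mono[OF finite_V V'(1)] by (intro mult_left_mono) (auto simp: c_def)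
    ultimately have "int (card E') * int (card V) \<le> int (card E) * int (card V')"
      by linarith
    then show ?thesis by (simp flip: of_nat_mult)
  qed simp
qed

end

section \<open>Locally planar sets\<close>

text \<open>Charts onto open subsets of the plane, for subsets of a Euclidean space: this is the form in which
invariance of domain and of dimension apply to the underlying set of a complex.
The type \<open>real \<times> real\<close> is chosen for the plane because maps out of it can be given by two parameters.\<close>

definition locally_planar :: "'a::euclidean_space set \<Rightarrow> bool" where
  "locally_planar X \<longleftrightarrow> (\<forall>x\<in>X. \<exists>N (W :: (real \<times> real) set).
     openin (top_of_set X) N \<and> x \<in> N \<and> open W \<and> N homeomorphic W)"

lemma manifold_imp_locally_planar:
  assumes M: "topological_manifold 2 M" and XM: "top_of_set X homeomorphic_space M"
  shows "locally_planar X"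
  unfolding locally_planar_def
proof
  fix x assume "x \<in> X"
  obtain h where h: "homeomorphic_map (top_of_set X) M h"
    using XM homeomorphic_space by blast
  then have hX: "h ` X = topspace M"
    using homeomorphic_imp_surjective_map by fastforce
  then have "h x \<in> topspace M" using \<open>x \<in> X\<close> by blast
  then obtain U V where U: "openin M U" "h x \<in> U" and V: "openin (Euclidean_space 2) V"
    and UV: "subtopology M U homeomorphic_space subtopology (Euclidean_space 2) V"
    using M unfolding topological_manifold_def by blast
  define N where "N = {z\<in>X. h z \<in> U}"
  have hN: "h ` N = U"
    using hX openin_subset[OF U(1)] by (auto simp: N_def)
  have N: "openin (top_of_set X) N"
    using homeomorphic_map_openness[OF h, of N] hN U(1) by (auto simp: N_def)
  have "homeomorphic_map (subtopology (top_of_set X) N) (subtopology M U) h"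
    using hN openin_subset[OF U(1)]
    by (intro homeomorphic_map_subtopologies[OF h]) (auto simp: N_def)
  moreover have "subtopology (top_of_set X) N = top_of_set N"
    by (simp add: subtopology_subtopology N_def Int_absorb1)
  ultimately have "top_of_set N homeomorphic_space subtopology M U"
    by (metis homeomorphic_map_imp_homeomorphic_space)
  also note UV
  also obtain e :: "(nat \<Rightarrow> real) \<Rightarrow> real \<times> real" and e'
    where "homeomorphic_maps (Euclidean_space DIM(real \<times> real)) euclidean e e'"
    by (rule homeomorphic_maps_Euclidean_space_euclidean)
  then have e: "homeomorphic_map (Euclidean_space 2) euclidean e"
    by (simp add: homeomorphic_maps_map numeral_2_eq_2)
  then have "homeomorphic_map (subtopology (Euclidean_space 2) V) (top_of_set (e ` V)) e"
    using openin_subset[OF V] by (intro homeomorphic_map_subtopologies) auto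
  then have "subtopology (Euclidean_space 2) V homeomorphic_space top_of_set (e ` V)"
    by (rule homeomorphic_map_imp_homeomorphic_space)
  finally have "N homeomorphic (e ` V)"
    by simp
  moreover have "open (e ` V)"
    using homeomorphic_map_openness[OF e openin_subset[OF V]] V by simp
  moreover have "x \<in> N"
    using \<open>x \<in> X\<close> U(2) by (simp add: N_def)
  ultimately show "\<exists>N (W :: (real \<times> real) set).
     openin (top_of_set X) N \<and> x \<in> N \<and> open W \<and> N homeomorphic W"
    using N by blast
qed

lemma planar_chart:
  assumes "locally_planar X" and U: "openin (top_of_set X) U" and "x \<in> U"
  obtains N f g and c :: "real \<times> real" and r where "openin (top_of_set X) N" "x \<in> N" "N \<subseteq> U"
    "0 < r" "homeomorphism N (ball c r) f g"
proof -
  have "x \<in> X" using U \<open>x \<in> U\<close> openin_imp_subset by blast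
  then obtain N and W :: "(real \<times> real) set"
    where N: "openin (top_of_set X) N" "x \<in> N" and W: "open W" and "N homeomorphic W"
    using assms(1) unfolding locally_planar_def by blast
  then obtain f g where fg: "homeomorphism N W f g"
    unfolding homeomorphic_def by blast
  have "openin (top_of_set N) (N \<inter> U)"
    using U N(1) openin_subset_trans[of X "N \<inter> U" N] openin_imp_subset[OF N(1)] by blast
  then have "openin (top_of_set W) (f ` (N \<inter> U))"
    using homeomorphism_imp_open_map[OF fg] by blast
  then have "open (f ` (N \<inter> U))"
    using W openin_open_trans by blast
  then obtain r where r: "0 < r" "ball (f x) r \<subseteq> f ` (N \<inter> U)"
    using N(2) \<open>x \<in> U\<close> by (metis IntI imageI open_contains_ball)
  define N' where "N' = g ` ball (f x) r"
  have sub: "ball (f x) r \<subseteq> W"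
    using r(2) fg by (auto simp: homeomorphism_def)
  have gf: "homeomorphism W N g f"
    using fg by (rule homeomorphism_symD)
  have "openin (top_of_set N) N'"
    unfolding N'_def using sub W
    by (intro homeomorphism_imp_open_map[OF gf]) (simp add: openin_open_eq)
  then have "openin (top_of_set X) N'"
    using N(1) by (rule openin_trans)
  moreover have "x \<in> N'"
    using r(1) N(2) homeomorphism_apply1[OF fg] unfolding N'_def
    by (metis centre_in_ball imageI)
  moreover have "N' \<subseteq> U"
    using r(2) homeomorphism_apply1[OF fg] unfolding N'_def by auto
  moreover have "homeomorphism (ball (f x) r) N' g f"
    using homeomorphism_of_subsets[OF gf sub subset_refl] N'_def by simp
  then have "homeomorphism N' (ball (f x) r) f g"
    by (rule homeomorphism_symD)
  ultimately show thesis using r(1) that by blast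
qed

text \<open>Restricting a chart embeds an open piece of \<open>A\<close> into the plane, and dimension is invariant.\<close>

lemma affine_part_dim_le:
  fixes A :: "'a::euclidean_space set"
  assumes X: "locally_planar X" and A: "affine A" and U: "openin (top_of_set A) U"
    and "U \<noteq> {}" "U \<subseteq> X"
  shows "aff_dim A \<le> 2"
proof -
  obtain x where x: "x \<in> U" using \<open>U \<noteq> {}\<close> by blast
  then have "x \<in> X" using \<open>U \<subseteq> X\<close> by blast
  then obtain N f g and c :: "real \<times> real" and r where
    N: "openin (top_of_set X) N" "x \<in> N" and fg: "homeomorphism N (ball c r) f g"
    using planar_chart[OF X openin_subtopology_self] by metis
  have "openin (top_of_set U) (U \<inter> N)"
  proof -
    obtain T where "open T" "N = X \<inter> T" using N(1) by (auto simp: openin_open)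
    then have "U \<inter> N = U \<inter> T" using \<open>U \<subseteq> X\<close> by blast
    then show ?thesis using \<open>open T\<close> by (simp add: openin_open_Int)
  qed
  then have "openin (top_of_set A) (U \<inter> N)"
    using U by (rule openin_trans)
  then have "aff_dim A \<le> aff_dim (UNIV :: (real \<times> real) set)"
  proof (rule invariance_of_dimension_affine_sets)
    show "continuous_on (U \<inter> N) f"
      using homeomorphism_cont1[OF fg] continuous_on_subset by blast
    show "inj_on f (U \<inter> N)"
      using homeomorphism_apply1[OF fg] by (intro inj_on_inverseI[of _ g]) auto
    show "U \<inter> N \<noteq> {}" using x N(2) by blast
  qed (use A in auto)
  then show ?thesis by simp
qed

text \<open>Conversely, the inverse of a chart embeds a disc into \<open>A\<close>; invariance of domain makes the image open
when \<open>A\<close> is a plane.\<close>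

lemma open_part_in_affine:
  fixes A :: "'a::euclidean_space set"
  assumes X: "locally_planar X" and A: "affine A" and U: "openin (top_of_set X) U" "U \<subseteq> A"
  shows "U \<noteq> {} \<Longrightarrow> 2 \<le> aff_dim A"
    and "aff_dim A \<le> 2 \<Longrightarrow> openin (top_of_set A) U"
proof -
  have local: "2 \<le> aff_dim A \<and> (aff_dim A \<le> 2 \<longrightarrow> (\<exists>N. openin (top_of_set A) N \<and> x \<in> N \<and> N \<subseteq> U))"
    if "x \<in> U" for x
  proof -
    from planar_chart[OF X U(1) that]
    obtain N f g and c :: "real \<times> real" and r where
      N: "x \<in> N" "N \<subseteq> U" and r: "0 < r" and fg: "homeomorphism N (ball c r) f g" .
    have ope: "openin (top_of_set (UNIV :: (real \<times> real) set)) (ball c r)" by simp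
    have cont: "continuous_on (ball c r) g"
      using homeomorphism_cont2[OF fg] .
    have gN: "g ` ball c r = N"
      using homeomorphism_image2[OF fg] .
    have inj: "inj_on g (ball c r)"
      using homeomorphism_apply2[OF fg] by (intro inj_on_inverseI[of _ f]) auto
    have gA: "g ` ball c r \<subseteq> A"
      using gN N(2) U(2) by blast
    have "aff_dim (UNIV :: (real \<times> real) set) \<le> aff_dim A"
      using invariance_of_dimension_affine_sets[OF ope affine_UNIV A cont gA inj] r by simp
    moreover have "openin (top_of_set A) (g ` ball c r)" if "aff_dim A \<le> 2"
      using invariance_of_domain_affine_sets[OF ope affine_UNIV A _ cont gA inj] that by simp
    ultimately show ?thesis
      using gN N by auto
  qed
  show "2 \<le> aff_dim A" if "U \<noteq> {}" using local that by blast
  show "openin (top_of_set A) U" if "aff_dim A \<le> 2"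
    by (subst openin_subopen) (use local that in blast)
qed

text \<open>Invariance of domain for a locally planar target: compose with a chart.\<close>

lemma plane_embedding_open:
  fixes h :: "real \<times> real \<Rightarrow> 'a::euclidean_space"
  assumes X: "locally_planar X" and W: "open W" and h: "continuous_on W h" "h ` W \<subseteq> X" "inj_on h W"
  shows "openin (top_of_set X) (h ` W)"
proof -
  have "\<exists>T. openin (top_of_set X) T \<and> h w \<in> T \<and> T \<subseteq> h ` W" if "w \<in> W" for w
  proof -
    have "h w \<in> X" using that h(2) by blast
    from planar_chart[OF X openin_subtopology_self this]
    obtain N f g and c :: "real \<times> real" and r where
      N: "openin (top_of_set X) N" "h w \<in> N" and fg: "homeomorphism N (ball c r) f g" by metis
    define W' where "W' = W \<inter> h -` N"
    have "openin (top_of_set W) W'"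
      unfolding W'_def using h(1,2) N(1) by (intro continuous_openin_preimage) auto
    then have W': "open W'" using W by (rule openin_open_trans)
    have "open ((f \<circ> h) ` W')"
    proof (rule invariance_of_domain)
      show "continuous_on W' (f \<circ> h)"
        using continuous_on_subset[OF h(1), of W'] continuous_on_subset[OF homeomorphism_cont1[OF fg], of "h ` W'"]
        by (intro continuous_on_compose) (auto simp: W'_def)
      show "inj_on (f \<circ> h) W'"
        using h(3) homeomorphism_apply1[OF fg] unfolding W'_def inj_on_def
        by (metis Int_iff comp_apply vimageE)
    qed (rule W')
    moreover have sub: "(f \<circ> h) ` W' \<subseteq> ball c r"
      using homeomorphism_image1[OF fg] by (auto simp: W'_def)
    ultimately have "openin (top_of_set (ball c r)) ((f \<circ> h) ` W')"
      by (simp add: openin_open_eq)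
    then have "openin (top_of_set N) (g ` (f \<circ> h) ` W')"
      by (rule homeomorphism_imp_open_map[OF homeomorphism_symD[OF fg]])
    moreover have "g ` (f \<circ> h) ` W' = h ` W'"
      using homeomorphism_apply1[OF fg] by (force simp: W'_def image_iff)
    ultimately have "openin (top_of_set X) (h ` W')"
      using N(1) openin_trans by metis
    moreover have "h w \<in> h ` W'" "h ` W' \<subseteq> h ` W"
      using that N(2) by (auto simp: W'_def)
    ultimately show ?thesis by blast
  qed
  then show ?thesis by (subst openin_subopen) auto
qed

lemma punctured_chart_connected:
  fixes N :: "'a::euclidean_space set"
  assumes "homeomorphism N (ball (c :: real \<times> real) r) f g"
  shows "connected (N - {p})"
proof -
  have fg: "homeomorphism (ball c r) N g f" using assms by (rule homeomorphism_symD)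
  have "connected (ball c r - {f p})"
    by (intro connected_open_delete) auto
  moreover have "connected (ball c r)" by simp
  moreover have "N - {p} = g ` (ball c r - {f p})" if "p \<in> N"
    using fg that unfolding homeomorphism_def by (auto simp: image_iff)
  moreover have "N - {p} = g ` ball c r" if "p \<notin> N"
    using fg that unfolding homeomorphism_def by auto
  moreover have "continuous_on (ball c r) g" using homeomorphism_cont1[OF fg] .
  ultimately show ?thesis
    by (metis Diff_subset connected_continuous_image continuous_on_subset)
qed

section \<open>Simplexes and their vertex sets\<close>

text \<open>Vertices are recovered from a simplex as a set as its extreme points.\<close>

definition verts :: "'a::euclidean_space set \<Rightarrow> 'a set" where
  "verts \<sigma> = {v. v extreme_point_of \<sigma>}"

lemma simplex_verts:
  assumes "n simplex \<sigma>"
  shows "convex hull verts \<sigma> = \<sigma>" "\<not> affine_dependent (verts \<sigma>)" "int (card (verts \<sigma>)) = n + 1"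
    "finite (verts \<sigma>)"
proof -
  obtain C where C: "\<not> affine_dependent C" "int (card C) = n + 1" "\<sigma> = convex hull C"
    using assms unfolding simplex_def by blast
  then have "verts \<sigma> = C"
    by (simp add: verts_def extreme_point_of_convex_hull_affine_independent)
  with C aff_independent_finite[OF C(1)]
  show "convex hull verts \<sigma> = \<sigma>" "\<not> affine_dependent (verts \<sigma>)" "int (card (verts \<sigma>)) = n + 1"
    "finite (verts \<sigma>)" by simp_all
qed

locale finite_complex =
  fixes S :: "'a::euclidean_space set set"
  assumes complex: "simplicial_complex S"
begin

lemma finite_S: "finite S"
  using complex by (simp add: simplicial_complex_def)

lemma ex_simplex: "\<sigma> \<in> S \<Longrightarrow> \<exists>n. n simplex \<sigma>"
  using complex by (simp add: simplicial_complex_def)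

lemma hull_verts: "\<sigma> \<in> S \<Longrightarrow> convex hull verts \<sigma> = \<sigma>"
  using ex_simplex simplex_verts(1) by blast

lemma verts_independent: "\<sigma> \<in> S \<Longrightarrow> \<not> affine_dependent (verts \<sigma>)"
  using ex_simplex simplex_verts(2) by blast

lemma finite_verts: "\<sigma> \<in> S \<Longrightarrow> finite (verts \<sigma>)"
  using ex_simplex simplex_verts(4) by blast

lemma card_verts: "\<sigma> \<in> S \<Longrightarrow> int (card (verts \<sigma>)) = aff_dim \<sigma> + 1"
  using ex_simplex simplex_verts(3) aff_dim_simplex by metis

lemma simplex_iff_aff_dim: "\<sigma> \<in> S \<Longrightarrow> n simplex \<sigma> \<longleftrightarrow> aff_dim \<sigma> = n"
  using ex_simplex aff_dim_simplex by metis

lemma closed_S: "\<sigma> \<in> S \<Longrightarrow> closed \<sigma>"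
  using ex_simplex closed_simplex by blast

lemma convex_S: "\<sigma> \<in> S \<Longrightarrow> convex \<sigma>"
  using ex_simplex convex_simplex by blast

lemma verts_subset_simplex: "verts \<sigma> \<subseteq> \<sigma>"
  by (auto simp: verts_def extreme_point_of_def)

lemma verts_inj: "inj_on verts S"
  using hull_verts by (rule inj_on_inverseI)

lemma hull_in_complex:
  assumes "\<sigma> \<in> S" "c \<subseteq> verts \<sigma>"
  shows "convex hull c \<in> S" "verts (convex hull c) = c"
proof -
  have "convex hull c face_of convex hull verts \<sigma>"
    using face_of_convex_hull_affine_independent[OF verts_independent[OF assms(1)]] assms(2) by blast
  then have "convex hull c face_of \<sigma>" using hull_verts assms(1) by simp
  then show "convex hull c \<in> S"
    using complex assms(1) unfolding simplicial_complex_def by blast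
  have "\<not> affine_dependent c"
    using affine_independent_subset[OF verts_independent[OF assms(1)] assms(2)] .
  then show "verts (convex hull c) = c"
    by (simp add: verts_def extreme_point_of_convex_hull_affine_independent)
qed

lemma Int_face:
  assumes "\<sigma> \<in> S" "\<tau> \<in> S"
  shows "\<sigma> \<inter> \<tau> face_of \<sigma>"
  using complex assms unfolding simplicial_complex_def by blast

lemma Int_in_complex:
  assumes "\<sigma> \<in> S" "\<tau> \<in> S"
  shows "\<sigma> \<inter> \<tau> \<in> S" "verts (\<sigma> \<inter> \<tau>) = verts \<sigma> \<inter> verts \<tau>"
proof -
  note 1 = Int_face[OF assms] and 2 = Int_face[OF assms(2,1)]
  show "\<sigma> \<inter> \<tau> \<in> S"
    using 1 complex assms(1) unfolding simplicial_complex_def by blast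
  show "verts (\<sigma> \<inter> \<tau>) = verts \<sigma> \<inter> verts \<tau>"
    using extreme_point_of_face[OF 1] extreme_point_of_face[OF 2] verts_subset_simplex
    by (auto simp: verts_def Int_commute)
qed

lemma subset_iff_verts:
  assumes "\<sigma> \<in> S" "\<tau> \<in> S"
  shows "\<sigma> \<subseteq> \<tau> \<longleftrightarrow> verts \<sigma> \<subseteq> verts \<tau>"
proof
  assume "\<sigma> \<subseteq> \<tau>"
  then have "\<sigma> \<inter> \<tau> = \<sigma>" by blast
  then show "verts \<sigma> \<subseteq> verts \<tau>" using Int_in_complex(2)[OF assms] by auto
next
  assume "verts \<sigma> \<subseteq> verts \<tau>"
  then show "\<sigma> \<subseteq> \<tau>"
    using hull_mono[of "verts \<sigma>" "verts \<tau>" convex] hull_verts assms by simp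
qed

lemma subset_same_dim_eq:
  assumes "\<sigma> \<in> S" "\<tau> \<in> S" "\<sigma> \<subseteq> \<tau>" "aff_dim \<tau> \<le> aff_dim \<sigma>"
  shows "\<sigma> = \<tau>"
proof -
  have "card (verts \<tau>) \<le> card (verts \<sigma>)"
    using card_verts assms by (metis add_le_cancel_right of_nat_le_iff)
  then have "verts \<sigma> = verts \<tau>"
    using subset_iff_verts assms finite_verts card_seteq by metis
  then show ?thesis using verts_inj assms by (meson inj_onD)
qed

text \<open>The open star. For \<open>\<sigma>\<close> in the complex it is the union of the relative interiors of the simplexes that
contain \<open>\<sigma>\<close>.\<close>

definition star :: "'a set \<Rightarrow> 'a set" where
  "star \<sigma> = \<Union>S - \<Union>{\<tau>\<in>S. \<not> \<sigma> \<subseteq> \<tau>}"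

lemma star_open: "openin (top_of_set (\<Union>S)) (star \<sigma>)"
proof -
  have "closed (\<Union>{\<tau>\<in>S. \<not> \<sigma> \<subseteq> \<tau>})"
    using finite_S closed_S by (intro closed_Union) auto
  then show ?thesis unfolding star_def
    by (simp add: Diff_eq openin_open_Int open_Compl)
qed

lemma star_subset: "star \<sigma> \<subseteq> \<Union>{\<tau>\<in>S. \<sigma> \<subseteq> \<tau>}"
  unfolding star_def by blast

lemma rel_interior_subset_star:
  assumes "\<sigma> \<in> S"
  shows "rel_interior \<sigma> \<subseteq> star \<sigma>"
proof
  fix z assume z: "z \<in> rel_interior \<sigma>"
  then have "z \<in> \<sigma>" using rel_interior_subset by blast
  moreover have "\<sigma> \<subseteq> \<tau>" if "\<tau> \<in> S" "z \<in> \<tau>" for \<tau>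
  proof -
    have "\<sigma> \<inter> \<tau> = \<sigma>"
      using face_of_disjoint_rel_interior[OF Int_face[OF assms that(1)]] z that(2) \<open>z \<in> \<sigma>\<close> by blast
    then show ?thesis by blast
  qed
  ultimately show "z \<in> star \<sigma>" using assms unfolding star_def by blast
qed

end

section \<open>Local structure and strong connectivity of a triangulated surface\<close>

locale triangulated_surface = finite_complex +
  assumes planar: "locally_planar (\<Union>S)"
    and connected_S: "connected (\<Union>S)"
    and nonempty: "\<Union>S \<noteq> {}"
begin

lemma aff_dim_le_2:
  assumes "\<sigma> \<in> S"
  shows "aff_dim \<sigma> \<le> 2"
proof (cases "\<sigma> = {}")
  case False
  then have "rel_interior \<sigma> \<noteq> {}"
    using rel_interior_eq_empty[OF convex_S[OF assms]] by simp
  moreover have "rel_interior \<sigma> \<subseteq> \<Union>S"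
    using assms rel_interior_subset by blast
  ultimately have "aff_dim (affine hull \<sigma>) \<le> 2"
    using affine_part_dim_le[OF planar affine_affine_hull openin_rel_interior] by blast
  then show ?thesis by (simp add: aff_dim_affine_hull)
qed simp

text \<open>The star of a maximal simplex is an open piece of the surface inside the simplex itself, so the simplex
cannot be thinner than the surface.\<close>

lemma maximal_aff_dim:
  assumes "\<sigma> \<in> S" "\<sigma> \<noteq> {}" "\<And>\<tau>. \<tau> \<in> S \<Longrightarrow> \<sigma> \<subseteq> \<tau> \<Longrightarrow> \<tau> = \<sigma>"
  shows "aff_dim \<sigma> = 2"
proof -
  have "star \<sigma> \<subseteq> \<sigma>" using star_subset assms(3) by blast
  then have "star \<sigma> \<subseteq> affine hull \<sigma>" using hull_subset by (rule subset_trans)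
  moreover have "star \<sigma> \<noteq> {}"
    using rel_interior_subset_star[OF assms(1)] rel_interior_eq_empty[OF convex_S[OF assms(1)]] assms(2)
    by auto
  ultimately have "2 \<le> aff_dim (affine hull \<sigma>)"
    using open_part_in_affine(1)[OF planar affine_affine_hull star_open] by blast
  then show ?thesis using aff_dim_le_2[OF assms(1)] by (simp add: aff_dim_affine_hull)
qed

lemma in_triangle:
  assumes "\<sigma> \<in> S" "\<sigma> \<noteq> {}"
  shows "\<exists>\<tau>\<in>S. \<sigma> \<subseteq> \<tau> \<and> aff_dim \<tau> = 2"
proof -
  obtain \<tau> where \<tau>: "\<tau> \<in> S" "\<sigma> \<subseteq> \<tau>" "\<And>\<rho>. \<rho> \<in> S \<Longrightarrow> \<tau> \<subseteq> \<rho> \<Longrightarrow> \<tau> = \<rho>"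
    using finite_has_maximal2[OF finite_S assms(1)] by blast
  then have "aff_dim \<tau> = 2" using maximal_aff_dim assms(2) by blast
  then show ?thesis using \<tau> by blast
qed

text \<open>If \<open>\<Delta>\<close> were the only triangle at \<open>\<epsilon>\<close>, then the star of \<open>\<epsilon>\<close> would be an open piece of the surface inside \<open>\<Delta>\<close>,
hence open in the plane of \<open>\<Delta>\<close>. But it contains points of an edge of \<open>\<Delta>\<close>.\<close>

lemma edge_in_second_triangle:
  assumes \<epsilon>: "\<epsilon> \<in> S" "aff_dim \<epsilon> = 1" and \<Delta>: "\<Delta> \<in> S" "aff_dim \<Delta> = 2" "\<epsilon> \<subseteq> \<Delta>"
  shows "\<exists>\<tau>\<in>S. \<epsilon> \<subseteq> \<tau> \<and> aff_dim \<tau> = 2 \<and> \<tau> \<noteq> \<Delta>"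
proof (rule ccontr)
  assume only: "\<not> ?thesis"
  have "\<tau> \<subseteq> \<Delta>" if "\<tau> \<in> S" "\<epsilon> \<subseteq> \<tau>" for \<tau>
  proof (cases "aff_dim \<tau> = 2")
    case True
    then show ?thesis using only that by blast
  next
    case False
    then have "\<epsilon> = \<tau>"
      using subset_same_dim_eq[OF \<epsilon>(1) that] aff_dim_le_2[OF that(1)] \<epsilon>(2) by simp
    then show ?thesis using \<Delta>(3) by simp
  qed
  then have sub: "star \<epsilon> \<subseteq> \<Delta>" using star_subset by blast
  have "star \<epsilon> \<subseteq> affine hull \<Delta>" using sub hull_subset by (rule subset_trans)
  then have "openin (top_of_set (affine hull \<Delta>)) (star \<epsilon>)"
    using open_part_in_affine(2)[OF planar affine_affine_hull star_open] \<Delta>(2)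
    by (simp add: aff_dim_affine_hull)
  with sub have "star \<epsilon> \<subseteq> rel_interior \<Delta>" by (rule rel_interior_maximal)
  then have "rel_interior \<epsilon> \<subseteq> rel_interior \<Delta>" using rel_interior_subset_star[OF \<epsilon>(1)] by blast
  moreover have "rel_interior \<epsilon> \<noteq> {}"
    using rel_interior_eq_empty[OF convex_S[OF \<epsilon>(1)]] \<epsilon>(2) by auto
  moreover have "\<epsilon> \<inter> rel_interior \<Delta> = {}"
  proof (rule face_of_disjoint_rel_interior)
    show "\<epsilon> face_of \<Delta>" using Int_face[OF \<Delta>(1) \<epsilon>(1)] \<Delta>(3) by (simp add: Int_absorb1)
    show "\<epsilon> \<noteq> \<Delta>" using \<epsilon>(2) \<Delta>(2) by auto
  qed
  ultimately show False using rel_interior_subset[of \<epsilon>] by blast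
qed

lemma triangles_meet_in_edge:
  assumes \<epsilon>: "\<epsilon> \<in> S" "aff_dim \<epsilon> = 1" and \<sigma>: "\<sigma> \<in> S" "aff_dim \<sigma> = 2" "\<epsilon> \<subseteq> \<sigma>"
    and \<tau>: "\<tau> \<in> S" "aff_dim \<tau> = 2" "\<epsilon> \<subseteq> \<tau>" and "\<sigma> \<noteq> \<tau>"
  shows "\<sigma> \<inter> \<tau> = \<epsilon>"
proof -
  have "\<sigma> \<inter> \<tau> \<noteq> \<sigma>"
    using subset_same_dim_eq[OF \<sigma>(1) \<tau>(1)] \<sigma>(2) \<tau>(2) \<open>\<sigma> \<noteq> \<tau>\<close> by auto
  then have "aff_dim (\<sigma> \<inter> \<tau>) < aff_dim \<sigma>"
    using face_of_aff_dim_lt[OF convex_S[OF \<sigma>(1)] Int_face[OF \<sigma>(1) \<tau>(1)]] by simp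
  then have "\<epsilon> = \<sigma> \<inter> \<tau>"
    using \<epsilon> \<sigma> \<tau> Int_in_complex(1)[OF \<sigma>(1) \<tau>(1)] by (intro subset_same_dim_eq) auto
  then show ?thesis by simp
qed

text \<open>Two triangles that meet in \<open>\<epsilon>\<close> contain an embedded open disc around the midpoint of \<open>\<epsilon>\<close>, which is open in the
surface by invariance of domain. So it swallows points of a third triangle that are close to the midpoint,
although the third triangle meets the other two only in \<open>\<epsilon>\<close>.\<close>

lemma no_three_triangles:
  assumes \<epsilon>: "\<epsilon> \<in> S" "aff_dim \<epsilon> = 1"
    and T: "\<And>i. i \<in> {1, 2, 3::nat} \<Longrightarrow> T i \<in> S \<and> aff_dim (T i) = 2 \<and> \<epsilon> \<subseteq> T i"
    and inj: "inj_on T {1, 2, 3}"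
  shows False
proof -
  have "card (verts \<epsilon>) = 2" using card_verts[OF \<epsilon>(1)] \<epsilon>(2) by simp
  then obtain a b where ab: "verts \<epsilon> = {a, b}" "a \<noteq> b" using card_2_iff by metis
  define L where "L = affine hull {a, b}"
  have affL: "affine L" by (simp add: L_def)
  have abL: "a \<in> L" "b \<in> L" by (simp_all add: L_def hull_inc)
  have \<epsilon>L: "\<epsilon> \<subseteq> L"
    using hull_verts[OF \<epsilon>(1)] ab(1) convex_hull_subset_affine_hull[of "{a, b}"] by (simp add: L_def)
  define m where "m = (1/2) *\<^sub>R (a + b)"
  have mL: "m \<in> L"
    using mem_affine[OF affL abL, of "1/2" "1/2"] by (simp add: m_def scaleR_add_right)
  have "\<exists>c. verts (T i) = {a, b, c} \<and> c \<notin> L" if i: "i \<in> {1, 2, 3::nat}" for i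
  proof -
    have Ti: "T i \<in> S" "aff_dim (T i) = 2" "\<epsilon> \<subseteq> T i" using T[OF i] by simp_all
    have c3: "card (verts (T i)) = 3" using card_verts[OF Ti(1)] Ti(2) by simp
    have sub: "{a, b} \<subseteq> verts (T i)" using subset_iff_verts[OF \<epsilon>(1) Ti(1)] Ti(3) ab(1) by simp
    have "card (verts (T i) - {a, b}) = 1"
      using c3 sub ab(2) by (simp add: card_Diff_subset)
    then obtain c where c: "verts (T i) - {a, b} = {c}" by (rule card_1_singletonE)
    then have eq: "verts (T i) = {a, b, c}" using sub by blast
    have "verts (T i) - {c} = {a, b}" using c sub by blast
    then have "c \<notin> L"
      using verts_independent[OF Ti(1)] eq unfolding affine_dependent_def L_def by auto
    with eq show ?thesis by blast
  qed
  then obtain c where c: "\<And>i. i \<in> {1, 2, 3::nat} \<Longrightarrow> verts (T i) = {a, b, c i} \<and> c i \<notin> L"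
    by metis
  have meet: "T i \<inter> T j \<subseteq> L" if "i \<in> {1, 2, 3}" "j \<in> {1, 2, 3}" "i \<noteq> j" for i j
  proof -
    have "T i \<noteq> T j" using that inj by (auto dest: inj_onD)
    then show ?thesis
      using triangles_meet_in_edge[OF \<epsilon>] T[OF that(1)] T[OF that(2)] \<epsilon>L by auto
  qed
  define P where "P s = m + s *\<^sub>R (b - a)" for s
  have PL: "P s \<in> L" for s
    unfolding P_def using affL mL abL by (intro mem_affine_3_minus)
  \<comment> \<open>the triangles are pages of a book with spine \<open>\<epsilon>\<close>; go by \<open>s\<close> along the spine, then by \<open>t\<close> towards \<open>c i\<close>\<close>
  define page where "page i s t = P s + t *\<^sub>R (c i - m)" for i :: nat and s t :: real
  \<comment> \<open>a point off the spine differs from the points of \<open>L\<close> by more than a translation along \<open>L\<close>\<close>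
  have off_axis: False
    if "i \<in> {1, 2, 3}" "t \<noteq> 0" "x \<in> L" "page i s t - x = y - z" "y \<in> L" "z \<in> L" for i s t x y z
  proof -
    have "t *\<^sub>R (c i - m) = x + (y - z) - P s"
      using that(4) by (simp add: page_def algebra_simps)
    then have "c i - m = (1/t) *\<^sub>R ((x + 1 *\<^sub>R (y - z)) - P s)"
      using that(2) by (metis divide_self_if mult.commute scaleR_one scaleR_scaleR times_divide_eq_right mult.right_neutral)
    then have "c i = m + (1/t) *\<^sub>R ((x + 1 *\<^sub>R (y - z)) - P s)"
      by (simp add: algebra_simps)
    also have "\<dots> \<in> L"
      using affL mL PL that by (intro mem_affine_3_minus) auto
    finally show False using c[OF that(1)] by simp
  qed
  have page_L: "t = 0" if "i \<in> {1, 2, 3}" "page i s t \<in> L" for i s t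
    using off_axis[of i t "page i s t" s "P 0" "P 0"] that PL by auto
  have page_T: "page i s t \<in> T i" if "i \<in> {1, 2, 3}" "\<bar>s\<bar> \<le> 1/4" "0 \<le> t" "t \<le> 1/4" for i s t
  proof -
    have "page i s t = ((1 - t)/2 - s) *\<^sub>R a + ((1 - t)/2 + s) *\<^sub>R b + t *\<^sub>R c i"
      by (simp add: page_def P_def m_def algebra_simps diff_divide_distrib) 
    moreover have "0 \<le> (1 - t)/2 - s" "0 \<le> (1 - t)/2 + s"
      using that by (auto simp: abs_le_iff field_simps)
    moreover have "(1 - t)/2 - s + ((1 - t)/2 + s) + t = 1" by (simp add: field_simps)
    ultimately have "page i s t \<in> convex hull {a, b, c i}"
      unfolding convex_hull_3 mem_Collect_eq using that(3) by blast
    then show ?thesis using hull_verts c[OF that(1)] T[OF that(1)] by metis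
  qed
  \<comment> \<open>the disc: the sign of the second parameter selects the triangle\<close>
  define h where "h = (\<lambda>(s, t). if 0 \<le> t then page 1 s t else page 2 s (- t))"
  \<comment> \<open>for parameters below 1/4 the barycentric coordinates on the pages are nonnegative\<close>
  define W where "W = {-1/4<..<1/4::real} \<times> {-1/4<..<1/4::real}"
  have h_page: "h (s, t) = page 1 s t" if "0 \<le> t" for s t using that by (simp add: h_def)
  have h_page': "h (s, t) = page 2 s (- t)" if "t \<le> 0" for s t
    using that by (auto simp: h_def page_def)
  have "h = (\<lambda>p. P (fst p) + max 0 (snd p) *\<^sub>R (c 1 - m) + max 0 (- snd p) *\<^sub>R (c 2 - m))"
    by (auto simp: h_def page_def fun_eq_iff max_def)
  then have cont: "continuous_on W h"
    by (auto simp: P_def intro!: continuous_intros)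
  have page_inj: "s = s' \<and> t = t'" if "i \<in> {1, 2, 3}" "page i s t = page i s' t'" for i s t s' t'
  proof -
    have "page i s (t - t') - P s = P s' - P s"
      using that(2) by (simp add: page_def algebra_simps)
    then have "t - t' = 0" using off_axis[of i "t - t'" "P s" s "P s'" "P s"] that(1) PL by blast
    moreover from this have "(s - s') *\<^sub>R (b - a) = 0"
      using that(2) by (simp add: page_def P_def algebra_simps)
    ultimately show ?thesis using ab(2) by simp
  qed
  have injh: "inj_on h W"
  proof -
    have cross: False if "0 \<le> t" "t' < 0" "(s, t) \<in> W" "(s', t') \<in> W" "h (s, t) = h (s', t')" for s t s' t'
    proof -
      have eq: "page 1 s t = page 2 s' (- t')" using that by (simp add: h_def)
      moreover have "page 1 s t \<in> T 1" using that by (intro page_T) (auto simp: W_def abs_le_iff)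
      moreover have "page 2 s' (- t') \<in> T 2" using that by (intro page_T) (auto simp: W_def abs_le_iff)
      ultimately have "page 2 s' (- t') \<in> L" using meet[of 1 2] by auto
      then show False using page_L[of 2 s' "- t'"] that(2) by simp
    qed
    have "p = q" if "p \<in> W" "q \<in> W" "h p = h q" for p q
    proof (cases p, cases q)
      fix s t s' t' assume pq: "p = (s, t)" "q = (s', t')"
      consider "0 \<le> t" "0 \<le> t'" | "t < 0" "t' < 0" | "0 \<le> t" "t' < 0" | "t < 0" "0 \<le> t'" by linarith
      then show "p = q"
      proof cases
        case 1
        then show ?thesis using page_inj[of 1 s t s' t'] that(3) pq by (simp add: h_def)
      next
        case 2
        then show ?thesis using page_inj[of 2 s "- t" s' "- t'"] that(3) pq by (simp add: h_def)
      next
        case 3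
        then show ?thesis using cross[of t t' s s'] that pq by auto
      next
        case 4
        then show ?thesis using cross[of t' t s' s] that pq by auto
      qed
    qed
    then show ?thesis by (rule inj_onI)
  qed
  have hT: "h ` W \<subseteq> T 1 \<union> T 2"
  proof
    fix z assume "z \<in> h ` W"
    then obtain s t where st: "(s, t) \<in> W" "z = h (s, t)" by auto
    show "z \<in> T 1 \<union> T 2"
    proof (cases "0 \<le> t")
      case True
      then have "z \<in> T 1" using st h_page by (auto intro!: page_T simp: W_def abs_le_iff)
      then show ?thesis by blast
    next
      case False
      then have "z \<in> T 2" using st h_page' by (auto intro!: page_T simp: W_def abs_le_iff)
      then show ?thesis by blast
    qed
  qed
  have "openin (top_of_set (\<Union>S)) (h ` W)"
  proof (rule plane_embedding_open[OF planar])
    show "open W" by (simp add: W_def open_Times)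
    show "h ` W \<subseteq> \<Union>S" using hT T[of 1] T[of 2] by auto
  qed (use cont injh in auto)
  moreover have "m = h (0, 0)" by (simp add: h_def page_def P_def)
  then have "m \<in> h ` W" by (auto simp: W_def)
  ultimately obtain e where e: "0 < e" "ball m e \<inter> \<Union>S \<subseteq> h ` W"
    using openin_contains_ball[of "\<Union>S" "h ` W"] by blast
  define k where "k = norm (c 3 - m) + 1"
  have k: "0 < k" unfolding k_def using norm_ge_zero[of "c 3 - m"] by linarith
  \<comment> \<open>small enough for a point of the third triangle in the ball of radius \<open>e\<close>\<close>
  define t where "t = min (1/4) (e / (2 * k))"
  have t: "0 < t" "t \<le> 1/4" using e(1) k by (simp_all only: t_def min.cobounded1) simp
  have "t * norm (c 3 - m) \<le> t * k" using t(1) by (simp add: k_def)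
  also have "\<dots> \<le> e / (2 * k) * k"
    using k by (intro mult_right_mono) (auto simp: t_def)
  also have "\<dots> = e / 2" using k by simp
  also have "\<dots> < e" using e(1) by simp
  finally have "dist m (page 3 0 t) < e"
    using t(1) by (simp add: dist_norm page_def P_def)
  moreover have T3: "page 3 0 t \<in> T 3" using t by (intro page_T) auto
  moreover have "T 3 \<in> S" using T[of 3] by simp
  ultimately have "page 3 0 t \<in> h ` W" using e(2) by auto
  then have "page 3 0 t \<in> L" using hT T3 meet[of 1 3] meet[of 2 3] by auto
  then show False using page_L[of 3 0 t] t(1) by simp
qed

lemma edge_in_two_triangles:
  assumes \<epsilon>: "\<epsilon> \<in> S" "aff_dim \<epsilon> = 1"
  shows "card {\<tau>\<in>S. aff_dim \<tau> = 2 \<and> \<epsilon> \<subseteq> \<tau>} = 2"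
proof -
  let ?A = "{\<tau>\<in>S. aff_dim \<tau> = 2 \<and> \<epsilon> \<subseteq> \<tau>}"
  have "\<epsilon> \<noteq> {}" using \<epsilon>(2) by auto
  then obtain \<sigma> where \<sigma>: "\<sigma> \<in> S" "aff_dim \<sigma> = 2" "\<epsilon> \<subseteq> \<sigma>" using in_triangle \<epsilon>(1) by blast
  then obtain \<tau> where \<tau>: "\<tau> \<in> S" "\<epsilon> \<subseteq> \<tau>" "aff_dim \<tau> = 2" "\<tau> \<noteq> \<sigma>"
    using edge_in_second_triangle[OF \<epsilon> \<sigma>] by auto
  have "?A = {\<sigma>, \<tau>}"
  proof
    show "{\<sigma>, \<tau>} \<subseteq> ?A" using \<sigma> \<tau> by blast
    show "?A \<subseteq> {\<sigma>, \<tau>}"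
    proof
      fix \<rho> assume \<rho>: "\<rho> \<in> ?A"
      show "\<rho> \<in> {\<sigma>, \<tau>}"
      proof (rule ccontr)
        assume "\<rho> \<notin> {\<sigma>, \<tau>}"
        then have ne: "\<rho> \<noteq> \<sigma>" "\<rho> \<noteq> \<tau>" by simp_all
        define T where "T i = (if i = 1 then \<sigma> else if i = 2 then \<tau> else \<rho>)" for i :: nat
        show False
        proof (rule no_three_triangles[OF \<epsilon>, of T])
          show "T i \<in> S \<and> aff_dim (T i) = 2 \<and> \<epsilon> \<subseteq> T i" for i
            using \<sigma> \<tau> \<rho> by (simp add: T_def)
          show "inj_on T {1, 2, 3}"
            using ne \<tau>(4) ne[symmetric] \<tau>(4)[symmetric] by (simp add: inj_on_def T_def)
        qed
      qed
    qed
  qed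
  then show ?thesis using \<tau>(4) by auto
qed

text \<open>Let \<open>D'\<close> consist of the other triangles. The unions of \<open>D\<close> and \<open>D'\<close> are closed, cover the surface, and meet only in
vertices. By connectedness they do meet, say in \<open>p\<close>. Near \<open>p\<close> there is no other common point, so a
punctured disc around \<open>p\<close> would be separated into two nonempty closed parts.\<close>

lemma triangles_strongly_connected:
  assumes D: "D \<subseteq> {\<tau>\<in>S. aff_dim \<tau> = 2}" "D \<noteq> {}"
    and closed_D: "\<And>\<sigma> \<tau>. \<lbrakk>\<sigma> \<in> D; \<tau> \<in> S; aff_dim \<tau> = 2; aff_dim (\<sigma> \<inter> \<tau>) = 1\<rbrakk> \<Longrightarrow> \<tau> \<in> D"
  shows "D = {\<tau>\<in>S. aff_dim \<tau> = 2}"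
proof (rule ccontr)
  assume neq: "D \<noteq> {\<tau>\<in>S. aff_dim \<tau> = 2}"
  define D' where "D' = {\<tau>\<in>S. aff_dim \<tau> = 2} - D"
  have D': "D' \<noteq> {}" "D' \<subseteq> {\<tau>\<in>S. aff_dim \<tau> = 2}"
    using D(1) neq by (auto simp: D'_def)
  have meet: "\<sigma> \<inter> \<tau> = {z}" if "\<sigma> \<in> D" "\<tau> \<in> D'" "z \<in> \<sigma> \<inter> \<tau>" for \<sigma> \<tau> z
  proof -
    have \<sigma>: "\<sigma> \<in> S" "aff_dim \<sigma> = 2" and \<tau>: "\<tau> \<in> S" "aff_dim \<tau> = 2" "\<tau> \<notin> D"
      using that D(1) by (auto simp: D'_def)
    have "\<sigma> \<inter> \<tau> \<noteq> \<sigma>"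
      using subset_same_dim_eq[OF \<sigma>(1) \<tau>(1)] \<sigma>(2) \<tau>(2,3) that(1) by auto
    then have "aff_dim (\<sigma> \<inter> \<tau>) < aff_dim \<sigma>"
      using face_of_aff_dim_lt[OF convex_S[OF \<sigma>(1)] Int_face[OF \<sigma>(1) \<tau>(1)]] by simp
    moreover have "aff_dim (\<sigma> \<inter> \<tau>) \<noteq> 1" using closed_D[OF that(1) \<tau>(1,2)] \<tau>(3) by blast
    moreover have "aff_dim (\<sigma> \<inter> \<tau>) \<noteq> -1" using that(3) aff_dim_empty[of "\<sigma> \<inter> \<tau>"] by auto
    moreover have "-1 \<le> aff_dim (\<sigma> \<inter> \<tau>)" by (rule aff_dim_geq)
    ultimately have "aff_dim (\<sigma> \<inter> \<tau>) = 0" using \<sigma>(2) by linarith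
    then have "\<exists>w. \<sigma> \<inter> \<tau> = {w}" by (simp add: aff_dim_eq_0)
    then show ?thesis using that(3) by (metis singletonD)
  qed
  have closed: "closed (\<Union>D)" "closed (\<Union>D')"
    using D(1) D'(2) finite_S closed_S by (auto intro!: closed_Union intro: finite_subset[of _ S])
  have cover: "\<Union>S \<subseteq> \<Union>D \<union> \<Union>D'"
  proof
    fix x assume "x \<in> \<Union>S"
    then obtain \<sigma> where "\<sigma> \<in> S" "x \<in> \<sigma>" by blast
    then obtain \<tau> where "\<tau> \<in> S" "\<sigma> \<subseteq> \<tau>" "aff_dim \<tau> = 2" using in_triangle[of \<sigma>] by blast
    then show "x \<in> \<Union>D \<union> \<Union>D'" using \<open>x \<in> \<sigma>\<close> by (auto simp: D'_def)
  qed
  have point: "\<exists>z. z \<in> \<sigma>" if "aff_dim \<sigma> = 2" for \<sigma> :: "'a set"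
    using that by (cases "\<sigma> = {}") auto
  have "\<Union>B \<inter> \<Union>S \<noteq> {}" if B: "B \<noteq> {}" "B \<subseteq> {\<tau>\<in>S. aff_dim \<tau> = 2}" for B
  proof -
    obtain \<beta> where "\<beta> \<in> B" using B(1) by blast
    moreover obtain z where "z \<in> \<beta>" using point[of \<beta>] B(2) \<open>\<beta> \<in> B\<close> by auto
    ultimately show ?thesis using B(2) by auto
  qed
  from this[OF D(2,1)] this[OF D'] have "\<Union>D \<inter> \<Union>D' \<inter> \<Union>S \<noteq> {}"
    using connected_closedD[OF connected_S _ cover closed] by auto
  then obtain p \<sigma>0 \<tau>0 where p: "p \<in> \<sigma>0" "p \<in> \<tau>0" "\<sigma>0 \<in> D" "\<tau>0 \<in> D'" by blast
  then have meet0: "\<sigma>0 \<inter> \<tau>0 = {p}" using meet by blast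
  have \<sigma>0: "\<sigma>0 \<in> S" "aff_dim \<sigma>0 = 2" and \<tau>0: "\<tau>0 \<in> S" "aff_dim \<tau>0 = 2"
    using p D(1) D'(2) by auto
  have pS: "{p} \<in> S" using Int_in_complex(1)[OF \<sigma>0(1) \<tau>0(1)] meet0 by simp
  have "p \<in> star {p}" using rel_interior_subset_star[OF pS] by simp
  then obtain N f g and c :: "real \<times> real" and r where
    N: "openin (top_of_set (\<Union>S)) N" "p \<in> N" "N \<subseteq> star {p}" and fg: "homeomorphism N (ball c r) f g"
    using planar_chart[OF planar star_open] by metis
  have "\<Union>D \<inter> \<Union>D' \<inter> (N - {p}) = {}"
  proof (rule ccontr)
    assume "\<not> ?thesis"
    then obtain z \<sigma> \<tau> where z: "z \<in> N" "z \<noteq> p" "z \<in> \<sigma> \<inter> \<tau>" "\<sigma> \<in> D" "\<tau> \<in> D'" by blast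
    then have "\<sigma> \<inter> \<tau> = {z}" using meet by blast
    moreover have "\<sigma> \<in> S" "\<tau> \<in> S" using z D(1) D'(2) by auto
    ultimately have "{z} \<in> S" using Int_in_complex(1) by metis
    then have "{p} \<subseteq> {z}" using z(1) N(3) unfolding star_def by blast
    then show False using z(2) by blast
  qed
  moreover have "connected (N - {p})" using punctured_chart_connected[OF fg] .
  moreover have "N - {p} \<subseteq> \<Union>D \<union> \<Union>D'" using cover openin_imp_subset[OF N(1)] by blast
  ultimately have "\<Union>D \<inter> (N - {p}) = {} \<or> \<Union>D' \<inter> (N - {p}) = {}"
    using connected_closedD[OF _ _ _ closed] by metis
  moreover have "\<exists>z\<in>\<rho>. z \<in> N - {p}" if "\<rho> \<in> S" "aff_dim \<rho> = 2" "p \<in> \<rho>" for \<rho>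
  proof -
    have "p islimpt \<rho>"
      using that convex_connected[OF convex_S[OF that(1)]] by (intro connected_imp_perfect_aff_dim) auto
    moreover obtain e where "0 < e" "ball p e \<inter> \<Union>S \<subseteq> N"
      using N(1,2) openin_contains_ball[of "\<Union>S" N] by blast
    ultimately obtain z where "z \<in> \<rho>" "z \<noteq> p" "dist z p < e"
      unfolding islimpt_approachable by blast
    then show ?thesis using \<open>ball p e \<inter> \<Union>S \<subseteq> N\<close> that(1) by (auto simp: dist_commute subset_iff)
  qed
  ultimately show False using \<sigma>0 \<tau>0 p by blast
qed

end

section \<open>The counting lemmas for triangulated surfaces\<close>

text \<open>Faces as abstract simplexes, i.e. as vertex sets.\<close>

definition faces :: "nat \<Rightarrow> 'a::euclidean_space set set \<Rightarrow> 'a set set" where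
  "faces i T = verts ` {\<sigma>\<in>T. int i simplex \<sigma>}"

context finite_complex
begin

lemma card_faces: "card (faces i S) = face_count i S"
  unfolding faces_def face_count_def
  by (intro card_image inj_on_subset[OF verts_inj]) auto

lemma mem_faces: "c \<in> faces i S \<longleftrightarrow> card c = Suc i \<and> (\<exists>\<sigma>\<in>S. c \<subseteq> verts \<sigma>)"
proof
  assume "c \<in> faces i S"
  then obtain \<sigma> where "\<sigma> \<in> S" "int i simplex \<sigma>" "c = verts \<sigma>"
    by (auto simp: faces_def)
  moreover from this have "card c = Suc i" using simplex_verts(3) by fastforce
  ultimately show "card c = Suc i \<and> (\<exists>\<sigma>\<in>S. c \<subseteq> verts \<sigma>)" by blast
next
  assume "card c = Suc i \<and> (\<exists>\<sigma>\<in>S. c \<subseteq> verts \<sigma>)"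
  then obtain \<sigma> where \<sigma>: "card c = Suc i" "\<sigma> \<in> S" "c \<subseteq> verts \<sigma>" by blast
  note c = hull_in_complex[OF \<sigma>(2,3)]
  have "aff_dim (convex hull c) = int i" using card_verts[OF c(1)] c(2) \<sigma>(1) by simp
  then have "int i simplex (convex hull c)" using simplex_iff_aff_dim[OF c(1)] by simp
  then show "c \<in> faces i S" unfolding faces_def using c by (intro image_eqI[of _ _ "convex hull c"]) auto
qed

lemma card_vertex_set: "card (\<Union>(verts ` S)) = face_count 0 S"
proof -
  have "faces 0 S = (\<lambda>v. {v}) ` \<Union>(verts ` S)"
  proof (intro equalityI subsetI)
    fix c assume "c \<in> faces 0 S"
    then show "c \<in> (\<lambda>v. {v}) ` \<Union>(verts ` S)"
      unfolding mem_faces by (auto simp: card_1_singleton_iff)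
  next
    fix c assume "c \<in> (\<lambda>v. {v}) ` \<Union>(verts ` S)"
    then show "c \<in> faces 0 S" unfolding mem_faces by auto
  qed
  then show ?thesis using card_faces[of 0] by (simp add: card_image)
qed

lemma vertex_set_nonempty:
  assumes "\<Union>S \<noteq> {}"
  shows "\<Union>(verts ` S) \<noteq> {}"
proof -
  obtain \<sigma> where "\<sigma> \<in> S" "\<sigma> \<noteq> {}" using assms by blast
  then have "verts \<sigma> \<noteq> {}" using hull_verts by force
  then show ?thesis using \<open>\<sigma> \<in> S\<close> by blast
qed

end

context triangulated_surface
begin

lemma face_of_dim: "\<sigma> \<in> S \<Longrightarrow> verts \<sigma> \<in> faces i S \<longleftrightarrow> aff_dim \<sigma> = int i"
  using card_verts[of \<sigma>] unfolding mem_faces by auto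

lemma face_verts:
  assumes "c \<in> faces i S"
  obtains \<sigma> where "\<sigma> \<in> S" "aff_dim \<sigma> = int i" "c = verts \<sigma>"
  using assms simplex_iff_aff_dim by (auto simp: faces_def)

sublocale closed_triangulation "\<Union>(verts ` S)" "faces 1 S" "faces 2 S"
proof
  show "finite (\<Union>(verts ` S))" using finite_S finite_verts by blast
  show "e \<subseteq> \<Union>(verts ` S) \<and> card e = 2" if "e \<in> faces 1 S" for e
    using that unfolding mem_faces by auto
  show "f \<subseteq> \<Union>(verts ` S) \<and> card f = 3" if "f \<in> faces 2 S" for f
    using that unfolding mem_faces by auto
  show "e \<in> faces 1 S" if "f \<in> faces 2 S" "e \<subseteq> f" "card e = 2" for e f
    using that unfolding mem_faces by auto
  show "card {f \<in> faces 2 S. e \<subseteq> f} = 2" if e: "e \<in> faces 1 S" for e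
  proof -
    obtain \<epsilon> where \<epsilon>: "\<epsilon> \<in> S" "aff_dim \<epsilon> = 1" "e = verts \<epsilon>"
      using face_verts[OF e] by auto
    have "{f \<in> faces 2 S. e \<subseteq> f} = verts ` {\<tau>\<in>S. aff_dim \<tau> = 2 \<and> \<epsilon> \<subseteq> \<tau>}"
    proof (intro equalityI subsetI)
      fix f assume f: "f \<in> {f \<in> faces 2 S. e \<subseteq> f}"
      then obtain \<tau> where "\<tau> \<in> S" "aff_dim \<tau> = 2" "f = verts \<tau>"
        using face_verts[of f 2] by auto
      then show "f \<in> verts ` {\<tau>\<in>S. aff_dim \<tau> = 2 \<and> \<epsilon> \<subseteq> \<tau>}"
        using f \<epsilon> subset_iff_verts by auto
    next
      fix f assume "f \<in> verts ` {\<tau>\<in>S. aff_dim \<tau> = 2 \<and> \<epsilon> \<subseteq> \<tau>}"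
      then show "f \<in> {f \<in> faces 2 S. e \<subseteq> f}"
        using \<epsilon> subset_iff_verts face_of_dim by auto
    qed
    moreover have "inj_on verts {\<tau>\<in>S. aff_dim \<tau> = 2 \<and> \<epsilon> \<subseteq> \<tau>}"
      using verts_inj by (rule inj_on_subset) auto
    ultimately show ?thesis
      using edge_in_two_triangles[OF \<epsilon>(1,2)] by (simp add: card_image)
  qed
  show "\<exists>f\<in>faces 2 S. v \<in> f" if v: "v \<in> \<Union>(verts ` S)" for v
  proof -
    obtain \<sigma> where \<sigma>: "\<sigma> \<in> S" "v \<in> verts \<sigma>" using v by blast
    then have "\<sigma> \<noteq> {}" using verts_subset_simplex by blast
    then obtain \<tau> where "\<tau> \<in> S" "\<sigma> \<subseteq> \<tau>" "aff_dim \<tau> = 2" using in_triangle \<sigma>(1) by blast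
    then show ?thesis using \<sigma> subset_iff_verts[of \<sigma> \<tau>] face_of_dim[of \<tau> 2] by auto
  qed
  show "D = faces 2 S"
    if D: "D \<subseteq> faces 2 S" "D \<noteq> {}"
      and cl: "\<And>e f g. \<lbrakk>f \<in> D; g \<in> faces 2 S; e \<in> faces 1 S; e \<subseteq> f; e \<subseteq> g\<rbrakk> \<Longrightarrow> g \<in> D" for D
  proof -
    define D' where "D' = {\<sigma>\<in>S. verts \<sigma> \<in> D}"
    have "D' = {\<tau>\<in>S. aff_dim \<tau> = 2}"
    proof (rule triangles_strongly_connected)
      show "D' \<subseteq> {\<tau>\<in>S. aff_dim \<tau> = 2}"
        using D(1) face_of_dim[of _ 2] by (auto simp: D'_def)
      obtain f where "f \<in> D" using D(2) by blast
      moreover then obtain \<tau> where "\<tau> \<in> S" "f = verts \<tau>" using face_verts D(1) by blast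
      ultimately show "D' \<noteq> {}" by (auto simp: D'_def)
      show "\<tau> \<in> D'" if "\<sigma> \<in> D'" "\<tau> \<in> S" "aff_dim \<tau> = 2" "aff_dim (\<sigma> \<inter> \<tau>) = 1" for \<sigma> \<tau>
      proof -
        have \<sigma>: "\<sigma> \<in> S" "verts \<sigma> \<in> D" using that(1) by (auto simp: D'_def)
        note meet = Int_in_complex[OF \<sigma>(1) that(2)]
        have "verts \<tau> \<in> D"
        proof (rule cl[OF \<sigma>(2)])
          show "verts \<tau> \<in> faces 2 S" using face_of_dim[OF that(2)] that(3) by simp
          show "verts (\<sigma> \<inter> \<tau>) \<in> faces 1 S" using face_of_dim[OF meet(1)] that(4) by simp
        qed (use meet(2) in auto)
        then show ?thesis using that(2) by (simp add: D'_def)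
      qed
    qed
    note D' = this
    have "f \<in> D" if f: "f \<in> faces 2 S" for f
    proof -
      obtain \<tau> where "\<tau> \<in> S" "aff_dim \<tau> = 2" "f = verts \<tau>"
        using face_verts[OF f] by auto
      then have "\<tau> \<in> D'" using D' by simp
      then show ?thesis using \<open>f = verts \<tau>\<close> by (simp add: D'_def)
    qed
    then show ?thesis using D(1) by auto
  qed
qed

lemma complex_dim_eq_2: "complex_dim S = 2"
proof -
  obtain \<sigma> where "\<sigma> \<in> S" "\<sigma> \<noteq> {}" using nonempty by blast
  then obtain \<tau> where "\<tau> \<in> S" "aff_dim \<tau> = 2" using in_triangle by blast
  then show ?thesis
    unfolding complex_dim_def using finite_S aff_dim_le_2
    by (intro Max_eqI) (auto simp: image_iff)
qed

lemma euler_char_eq: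
  "euler_char S = int (face_count 0 S) - int (face_count 1 S) + int (face_count 2 S)"
  unfolding euler_char_def complex_dim_eq_2 by (simp add: numeral_2_eq_2)

text \<open>The inequality for triangles follows from the one for edges by \<open>3 t \<le> 2 e\<close> and \<open>3 f\<^sub>2 = 2 f\<^sub>1\<close>.\<close>

lemma subcomplex_density:
  assumes T: "subcomplex T S" "\<Union>T \<noteq> {}" and \<chi>: "0 \<le> euler_char S"
  shows "face_count 1 T * face_count 0 S \<le> face_count 1 S * face_count 0 T"
    and "face_count 2 T * face_count 0 S \<le> face_count 2 S * face_count 0 T"
proof -
  have TS: "T \<subseteq> S" using T(1) by (simp add: subcomplex_def)
  interpret T: finite_complex T using T(1) by unfold_locales (simp add: subcomplex_def)
  have sub: "faces i T \<subseteq> faces i S" for i using TS by (auto simp: faces_def)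
  have "card (faces 1 T) * card (\<Union>(verts ` S)) \<le> card (faces 1 S) * card (\<Union>(verts ` T))"
  proof (rule edge_density)
    show "\<Union>(verts ` T) \<subseteq> \<Union>(verts ` S)" using TS by blast
    show "\<Union>(verts ` T) \<noteq> {}" using T.vertex_set_nonempty[OF T(2)] .
    show "faces 1 T \<subseteq> Pow (\<Union>(verts ` T))" using T.mem_faces[of _ 1] by blast
    show "0 \<le> int (card (\<Union>(verts ` S))) - int (card (faces 1 S)) + int (card (faces 2 S))"
      using \<chi> by (simp add: euler_char_eq card_faces card_vertex_set)
  qed (rule sub)
  then show edges: "face_count 1 T * face_count 0 S \<le> face_count 1 S * face_count 0 T"
    by (simp only: card_faces T.card_faces card_vertex_set T.card_vertex_set)
  have "3 * card (faces 2 T) \<le> 2 * card (faces 1 T)"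
  proof (rule triangles_le_edges[OF sub sub])
    fix e f assume "f \<in> faces 2 T" "e \<in> faces 1 S" "e \<subseteq> f"
    then show "e \<in> faces 1 T" unfolding T.mem_faces mem_faces by blast
  qed
  then have "3 * face_count 2 T * face_count 0 S \<le> 2 * face_count 1 T * face_count 0 S"
    by (intro mult_right_mono) (simp_all only: T.card_faces)
  also have "\<dots> \<le> 2 * face_count 1 S * face_count 0 T"
    using edges by simp
  also have "2 * face_count 1 S = 3 * face_count 2 S"
    using three_triangles_eq_two_edges by (simp only: card_faces)
  finally show "face_count 2 T * face_count 0 S \<le> face_count 2 S * face_count 0 T" by simp
qed

end

section \<open>Density domains\<close>

lemma sum_density:
  assumes "0 < face_count 0 T"
  shows "(\<Sum>i=1..r. ereal (\<alpha> i) / vertex_density i T)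
       = ereal (\<Sum>i=1..r. \<alpha> i * (real (face_count i T) / real (face_count 0 T)))"
proof -
  have "ereal (\<alpha> i) / vertex_density i T = ereal (\<alpha> i * (real (face_count i T) / real (face_count 0 T)))" for i
    using assms by (auto simp: vertex_density_def)
  then show ?thesis by simp
qed

lemma mem_density_domain:
  assumes "0 < face_count 0 T"
  shows "\<alpha> \<in> density_domain r T \<longleftrightarrow> \<alpha> \<in> {1..r} \<rightarrow>\<^sub>E UNIV \<and> (\<forall>i\<in>{1..r}. 0 \<le> \<alpha> i) \<and>
    (\<Sum>i=1..r. \<alpha> i * (real (face_count i T) / real (face_count 0 T))) < 1"
  unfolding density_domain_def mem_Collect_eq sum_density[OF assms] one_ereal_def ereal_less_eq less_ereal.simps
  by blast

lemma density_domain_mono: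
  assumes pos: "0 < face_count 0 S" "0 < face_count 0 T"
    and le: "\<And>i. i \<in> {1..r} \<Longrightarrow> face_count i T * face_count 0 S \<le> face_count i S * face_count 0 T"
  shows "density_domain r S \<subseteq> density_domain r T"
proof
  fix \<alpha> assume \<alpha>: "\<alpha> \<in> density_domain r S"
  have ratio: "real (face_count i T) / real (face_count 0 T) \<le> real (face_count i S) / real (face_count 0 S)"
    if "i \<in> {1..r}" for i
  proof -
    have "real (face_count i T * face_count 0 S) \<le> real (face_count i S * face_count 0 T)"
      using le[OF that] by (rule of_nat_mono)
    then show ?thesis using pos by (simp add: frac_le_eq divide_simps mult.commute)
  qed
  have nonneg: "0 \<le> \<alpha> i" if "i \<in> {1..r}" for i
    using \<alpha> mem_density_domain[OF pos(1)] that by blast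
  have "(\<Sum>i=1..r. \<alpha> i * (real (face_count i T) / real (face_count 0 T)))
      \<le> (\<Sum>i=1..r. \<alpha> i * (real (face_count i S) / real (face_count 0 S)))"
    by (intro sum_mono mult_left_mono ratio nonneg)
  also have "\<dots> < 1"
    using \<alpha> mem_density_domain[OF pos(1)] by blast
  finally show "\<alpha> \<in> density_domain r T"
    using \<alpha> mem_density_domain[OF pos(1)] mem_density_domain[OF pos(2)] by blast
qed

theorem theorem4p4:
  fixes S :: "'a::euclidean_space set set" and M :: "'b topology"
  assumes "closed_surface M"
    and "triangulates S M"
    and "euler_char S \<ge> 0"
  shows "balanced 2 S"
proof -
  have complex: "simplicial_complex S" and XM: "top_of_set (\<Union>S) homeomorphic_space M"
    using assms(2) by (auto simp: triangulates_def)
  have M: "topological_manifold 2 M" "connected_space M" "topspace M \<noteq> {}"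
    using assms(1) by (auto simp: closed_surface_def)
  interpret triangulated_surface S
  proof
    show "simplicial_complex S" by (rule complex)
    show "locally_planar (\<Union>S)" by (rule manifold_imp_locally_planar[OF M(1) XM])
    show "connected (\<Union>S)"
      using homeomorphic_connected_space[OF XM] M(2) by (simp flip: connectedin_iff_connected add: connectedin_def)
    show "\<Union>S \<noteq> {}"
    proof -
      obtain h where "homeomorphic_map (top_of_set (\<Union>S)) M h"
        using XM homeomorphic_space by blast
      from homeomorphic_imp_surjective_map[OF this] have "h ` \<Union>S = topspace M" by simp
      then show ?thesis using M(3) by (metis image_empty)
    qed
  qed
  have pos: "0 < face_count 0 T" if "subcomplex T S" "\<Union>T \<noteq> {}" for T
  proof -
    interpret T: finite_complex T using that(1) by unfold_locales (simp add: subcomplex_def)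
    have "finite (\<Union>(verts ` T))" using T.finite_S T.finite_verts by blast
    then show ?thesis
      using T.vertex_set_nonempty[OF that(2)] by (simp add: card_gt_0_iff flip: T.card_vertex_set)
  qed
  have self: "subcomplex S S" using complex by (simp add: subcomplex_def)
  have "density_domain 2 S \<subseteq> density_domain 2 T" if T: "subcomplex T S" "\<Union>T \<noteq> {}" for T
  proof (rule density_domain_mono)
    fix i :: nat assume "i \<in> {1..2}"
    then have "i = 1 \<or> i = 2" by auto
    then show "face_count i T * face_count 0 S \<le> face_count i S * face_count 0 T"
      using subcomplex_density[OF T assms(3)] by auto
  qed (use pos[OF self nonempty] pos[OF T] in auto)
  then have "reduced_density_domain 2 S = density_domain 2 S"
    unfolding reduced_density_domain_def using self nonempty by blast
  then show ?thesis
    using complex complex_dim_eq_2 by (simp add: balanced_def)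
qed

end
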